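(* Let $H=H_0+V$ where $V$ is $(\Gamma,\mathcal M)$ pseudo-ergodic, and let $E=\mathrm{Spec}(H_0)$. Then $$E+\mathrm{Spec}(\mathcal M)\subseteq \mathrm{Spec}(H)\subseteq \mathrm{Num}(H_0)+\mathrm{Conv}(\mathrm{Num}(\mathcal M)).$$ If $H_0$ is normal and $A$ is normal for every $A\in\mathcal M$, then $$\mathrm{Spec}(H)\subseteq \mathrm{Conv}(E)+\mathrm{Conv}(\mathrm{Spec}(\mathcal M)).$$
   Context: $X$ is a countable set on which a group $\Gamma$ acts by permutations, $\mathcal K$ is a complex Hilbert space, and operators act on $l^2(X,\mathcal K)\cong l^2(X)\otimes\mathcal K$. For $\gamma\in\Gamma$ the unitary $U_\gamma$ is $(U_\gamma f)(x)=f(\gamma^{-1}x)$. $H_0$ is a bounded operator on $l^2(X)$ with $H_0U_\gamma=U_\gamma H_0$ for all $\gamma\in\Gamma$; the operator $H_0\otimes I$ on $l^2(X,\mathcal K)$ is also written $H_0$. $\mathcal M\subseteq\mathcal L(\mathcal K)$ (bounded operators on $\mathcal K$) is a norm closed, bounded set. A function $V:X\to\mathcal M$ is identified with the bounded operator $(Vf)(x)=V(x)f(x)$. A potential $V:X\to\mathcal M$ is $(\Gamma,\mathcal M)$ pseudo-ergodic if for every $\varepsilon>0$, every finite $F\subset X$ and every $W:F\to\mathcal M$ there exists $\gamma\in\Gamma$ such that $\|W(x)-V(\gamma x)\|<\varepsilon$ for all $x\in F$. $\mathrm{Num}(A)$ denotes the closure of the numerical range $\{\langle Af,f\rangle:\|f\|=1\}$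 of a bounded operator $A$; $\mathrm{Conv}$ denotes the closed convex hull of a subset of $\mathbf C$; $\mathrm{Spec}(\mathcal M)=\overline{\bigcup_{A\in\mathcal M}\mathrm{Spec}(A)}$ and $\mathrm{Num}(\mathcal M)=\overline{\bigcup_{A\in\mathcal M}\mathrm{Num}(A)}$. Sums of sets are Minkowski sums. *)

theory Defs
  imports "HOL-Analysis.Analysis" "HOL-Algebra.Group_Action"
begin

section \<open>Complex Hilbert spaces\<close>

text \<open>
  The norm, the metric and completeness come from the underlying real Hilbert space, whose inner
  product is the real part of the complex one.  The complex inner product is linear in its first
  argument.
\<close>

class complex_hilbert = real_inner + banach +
  fixes scaleC :: "complex \<Rightarrow> 'a \<Rightarrow> 'a"  (infixr "*\<^sub>C" 75)
    and cinner :: "'a \<Rightarrow> 'a \<Rightarrow> complex"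
  assumes scaleC_add_right: "a *\<^sub>C (x + y) = a *\<^sub>C x + a *\<^sub>C y"
    and scaleC_add_left: "(a + b) *\<^sub>C x = a *\<^sub>C x + b *\<^sub>C x"
    and scaleC_scaleC: "a *\<^sub>C (b *\<^sub>C x) = (a * b) *\<^sub>C x"
    and scaleC_of_real: "complex_of_real r *\<^sub>C x = r *\<^sub>R x"
    and cinner_commute: "cinner x y = cnj (cinner y x)"
    and cinner_add_left: "cinner (x + y) z = cinner x z + cinner y z"
    and cinner_scaleC_left: "cinner (a *\<^sub>C x) y = a * cinner x y"
    and inner_eq_Re_cinner: "inner x y = Re (cinner x y)"
begin

lemma cinner_add_right: "cinner x (y + z) = cinner x y + cinner x z"
  by (metis cinner_add_left cinner_commute complex_cnj_add)

lemma cinner_scaleC_right: "cinner x (a *\<^sub>C y) = cnj a * cinner x y"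
  by (metis cinner_commute cinner_scaleC_left complex_cnj_mult)

lemma cinner_self: "cinner x x = complex_of_real ((norm x)\<^sup>2)"
proof -
  have "Im (cinner x x) = 0"
    by (metis cinner_commute complex_cnj neg_equal_zero complex.sel(2) complex.collapse)
  moreover have "Re (cinner x x) = (norm x)\<^sup>2"
    by (simp add: inner_eq_Re_cinner[symmetric] norm_eq_sqrt_inner)
  ultimately show ?thesis by (simp add: complex_eq_iff)
qed

lemma norm_scaleC: "norm (a *\<^sub>C x) = cmod a * norm x"
proof -
  have "complex_of_real ((norm (a *\<^sub>C x))\<^sup>2) = a * cnj a * complex_of_real ((norm x)\<^sup>2)"
    by (metis cinner_self cinner_scaleC_left cinner_scaleC_right mult.assoc)
  also have "\<dots> = complex_of_real ((cmod a * norm x)\<^sup>2)"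
    by (simp only: complex_norm_square[symmetric] of_real_mult of_real_power power_mult_distrib)
  finally have "(norm (a *\<^sub>C x))\<^sup>2 = (cmod a * norm x)\<^sup>2"
    using of_real_eq_iff by blast
  then show ?thesis by simp
qed

lemma cmod_cinner_le: "cmod (cinner x y) \<le> norm x * norm y"
proof (cases "cinner x y = 0")
  case False
  define c where "c = cnj (sgn (cinner x y))"
  have c: "cmod c = 1" using False by (simp add: c_def norm_sgn)
  have "c * cinner x y = complex_of_real (cmod (cinner x y))"
    using False unfolding c_def sgn_eq
    by (simp add: complex_norm_square[symmetric] mult.commute field_simps power2_eq_square)
  then have "cmod (cinner x y) = inner (c *\<^sub>C x) y"
    by (simp add: inner_eq_Re_cinner cinner_scaleC_left)
  also have "\<dots> \<le> norm (c *\<^sub>C x) * norm y"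
    by (rule norm_cauchy_schwarz)
  finally show ?thesis using c by (simp add: norm_scaleC)
qed simp

end

instantiation complex :: complex_hilbert
begin

definition scaleC_complex :: "complex \<Rightarrow> complex \<Rightarrow> complex"
  where "scaleC_complex a z = a * z"

definition cinner_complex :: "complex \<Rightarrow> complex \<Rightarrow> complex"
  where "cinner_complex z w = z * cnj w"

instance
  by standard
    (simp_all add: scaleC_complex_def cinner_complex_def inner_complex_def algebra_simps
      scaleR_conv_of_real)

end


section \<open>The Hilbert space of square summable functions\<close>

definition square_summable :: "('x \<Rightarrow> 'k::complex_hilbert) \<Rightarrow> bool"
  where "square_summable f \<longleftrightarrow> (\<lambda>x. (norm (f x))\<^sup>2) summable_on UNIV"

lemma square_summable_zero: "square_summable (\<lambda>_. 0)"
  by (simp add: square_summable_def)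

typedef (overloaded) ('x, 'k) ell2 = "{f :: 'x \<Rightarrow> 'k::complex_hilbert. square_summable f}"
  morphisms ell2_apply Abs_ell2
  using square_summable_zero by blast

setup_lifting type_definition_ell2

lemma ell2_eqI: "(\<And>x. ell2_apply f x = ell2_apply g x) \<Longrightarrow> f = g"
  by (simp add: fun_eq_iff flip: ell2_apply_inject)

lemma square_summable_boundedI:
  assumes "\<And>F. finite F \<Longrightarrow> (\<Sum>x\<in>F. (norm (f x))\<^sup>2) \<le> C"
  shows "square_summable f"
  unfolding square_summable_def
  by (rule nonneg_bdd_above_summable_on) (auto intro!: bdd_aboveI2[where M=C] assms)

lemma square_summable_add:
  assumes "square_summable f" "square_summable g"
  shows "square_summable (\<lambda>x. f x + g x)"
proof -
  have "(\<lambda>x. 2 * (norm (f x))\<^sup>2 + 2 * (norm (g x))\<^sup>2) summable_on UNIV"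
    using assms unfolding square_summable_def
    by (intro summable_on_add summable_on_cmult_right) auto
  then show ?thesis
    unfolding square_summable_def
  proof (rule summable_on_comparison_test)
    fix x
    have "(norm (f x + g x))\<^sup>2 \<le> (norm (f x) + norm (g x))\<^sup>2"
      by (simp add: power_mono norm_triangle_ineq)
    also have "\<dots> \<le> 2 * (norm (f x))\<^sup>2 + 2 * (norm (g x))\<^sup>2"
      using sum_squares_bound[of "norm (f x)" "norm (g x)"] by (simp add: power2_sum)
    finally show "(norm (f x + g x))\<^sup>2 \<le> 2 * (norm (f x))\<^sup>2 + 2 * (norm (g x))\<^sup>2" .
  qed auto
qed

lemma square_summable_bounded:
  assumes "square_summable f" "\<And>x. norm (g x) \<le> C * norm (f x)"
  shows "square_summable g"
proof -
  have "(\<lambda>x. C\<^sup>2 * (norm (f x))\<^sup>2) summable_on UNIV"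
    using assms(1) unfolding square_summable_def by (rule summable_on_cmult_right)
  then show ?thesis
    unfolding square_summable_def
    by (rule summable_on_comparison_test)
      (use assms(2) in \<open>auto simp flip: power_mult_distrib intro!: power_mono\<close>)
qed

lemma cinner_summable:
  assumes "square_summable f" "square_summable g"
  shows "(\<lambda>x. cinner (f x) (g x)) summable_on UNIV"
proof (rule abs_summable_summable)
  have "(\<lambda>x. (norm (f x))\<^sup>2 + (norm (g x))\<^sup>2) summable_on UNIV"
    using assms unfolding square_summable_def by (rule summable_on_add)
  then show "(\<lambda>x. cmod (cinner (f x) (g x))) summable_on UNIV"
  proof (rule summable_on_comparison_test)
    fix x
    have "cmod (cinner (f x) (g x)) \<le> norm (f x) * norm (g x)"
      by (rule cmod_cinner_le)
    also have "\<dots> \<le> (norm (f x))\<^sup>2 + (norm (g x))\<^sup>2"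
      using sum_squares_bound[of "norm (f x)" "norm (g x)"]
        mult_nonneg_nonneg[OF norm_ge_zero[of "f x"] norm_ge_zero[of "g x"]] by linarith
    finally show "cmod (cinner (f x) (g x)) \<le> (norm (f x))\<^sup>2 + (norm (g x))\<^sup>2" .
  qed auto
qed

instantiation ell2 :: (type, complex_hilbert) real_inner
begin

lift_definition zero_ell2 :: "('a, 'b) ell2" is "\<lambda>_. 0"
  by (rule square_summable_zero)

lift_definition plus_ell2 :: "('a, 'b) ell2 \<Rightarrow> ('a, 'b) ell2 \<Rightarrow> ('a, 'b) ell2"
  is "\<lambda>f g x. f x + g x"
  by (rule square_summable_add)

lift_definition uminus_ell2 :: "('a, 'b) ell2 \<Rightarrow> ('a, 'b) ell2" is "\<lambda>f x. - f x"
  by (simp add: square_summable_def)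

lift_definition minus_ell2 :: "('a, 'b) ell2 \<Rightarrow> ('a, 'b) ell2 \<Rightarrow> ('a, 'b) ell2"
  is "\<lambda>f g x. f x - g x"
  using square_summable_add[of _ "\<lambda>x. - g x" for g] by (simp add: square_summable_def)

lift_definition scaleR_ell2 :: "real \<Rightarrow> ('a, 'b) ell2 \<Rightarrow> ('a, 'b) ell2" is "\<lambda>r f x. r *\<^sub>R f x"
  by (rule square_summable_bounded) auto

lift_definition inner_ell2 :: "('a, 'b) ell2 \<Rightarrow> ('a, 'b) ell2 \<Rightarrow> real"
  is "\<lambda>f g. Re (\<Sum>\<^sub>\<infinity>x. cinner (f x) (g x))" .

definition norm_ell2 :: "('a, 'b) ell2 \<Rightarrow> real"
  where "norm_ell2 f = sqrt (inner f f)"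

definition sgn_ell2 :: "('a, 'b) ell2 \<Rightarrow> ('a, 'b) ell2"
  where "sgn_ell2 f = scaleR (inverse (norm f)) f"

definition dist_ell2 :: "('a, 'b) ell2 \<Rightarrow> ('a, 'b) ell2 \<Rightarrow> real"
  where "dist_ell2 f g = norm (f - g)"

definition uniformity_ell2 :: "(('a, 'b) ell2 \<times> ('a, 'b) ell2) filter"
  where "uniformity_ell2 = (INF e\<in>{0<..}. principal {(x, y). dist x y < e})"

definition open_ell2 :: "('a, 'b) ell2 set \<Rightarrow> bool"
  where "open_ell2 S = (\<forall>x\<in>S. \<forall>\<^sub>F (x', y) in uniformity. x' = x \<longrightarrow> y \<in> S)"

lemma inner_ell2_self: "inner f f = (\<Sum>\<^sub>\<infinity>x. (norm (ell2_apply f x))\<^sup>2)" for f :: "('a, 'b) ell2"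
proof (transfer)
  fix f :: "'a \<Rightarrow> 'b" assume "square_summable f"
  then have "((\<lambda>x. (norm (f x))\<^sup>2) has_sum (\<Sum>\<^sub>\<infinity>x. (norm (f x))\<^sup>2)) UNIV"
    by (simp add: square_summable_def)
  then have "((\<lambda>x. cinner (f x) (f x)) has_sum complex_of_real (\<Sum>\<^sub>\<infinity>x. (norm (f x))\<^sup>2)) UNIV"
    unfolding cinner_self by (rule has_sum_of_real)
  then show "Re (\<Sum>\<^sub>\<infinity>x. cinner (f x) (f x)) = (\<Sum>\<^sub>\<infinity>x. (norm (f x))\<^sup>2)"
    by (simp add: infsumI)
qed

instance
proof
  fix f g h :: "('a, 'b) ell2" and r s :: real
  show "f + g + h = f + (g + h)" "f + g = g + f" "0 + f = f" "- f + f = 0" "f - g = f + - g"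
    by (transfer; simp add: algebra_simps)+
  show "r *\<^sub>R (f + g) = r *\<^sub>R f + r *\<^sub>R g" "(r + s) *\<^sub>R f = r *\<^sub>R f + s *\<^sub>R f"
    "r *\<^sub>R s *\<^sub>R f = (r * s) *\<^sub>R f" "1 *\<^sub>R f = f"
    by (transfer; simp add: algebra_simps)+
  show "sgn f = scaleR (inverse (norm f)) f" by (rule sgn_ell2_def)
  show "dist f g = norm (f - g)" by (rule dist_ell2_def)
  show "norm f = sqrt (inner f f)" by (rule norm_ell2_def)
  show "(uniformity :: (('a, 'b) ell2 \<times> ('a, 'b) ell2) filter)
      = (INF e\<in>{0<..}. principal {(x, y). dist x y < e})"
    by (rule uniformity_ell2_def)
  show "open S = (\<forall>x\<in>S. \<forall>\<^sub>F (x', y) in uniformity. x' = x \<longrightarrow> y \<in> S)" for S :: "('a, 'b) ell2 set"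
    by (rule open_ell2_def)
  show "inner f g = inner g f"
  proof (transfer)
    fix f g :: "'a \<Rightarrow> 'b"
    have "(\<Sum>\<^sub>\<infinity>x. cinner (f x) (g x)) = cnj (\<Sum>\<^sub>\<infinity>x. cinner (g x) (f x))"
      by (subst infsum_cnj[symmetric], rule infsum_cong, rule cinner_commute)
    then show "Re (\<Sum>\<^sub>\<infinity>x. cinner (f x) (g x)) = Re (\<Sum>\<^sub>\<infinity>x. cinner (g x) (f x))"
      by simp
  qed
  show "inner (f + g) h = inner f h + inner g h"
    by transfer (simp add: cinner_add_left infsum_add cinner_summable)
  show "inner (r *\<^sub>R f) g = r * inner f g"
    by transfer (simp add: cinner_scaleC_left infsum_cmult_right' flip: scaleC_of_real)
  show "0 \<le> inner f f"
    unfolding inner_ell2_self by (rule infsum_nonneg) simp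
  show "inner f f = 0 \<longleftrightarrow> f = 0"
  proof
    assume "inner f f = 0"
    then have "(norm (ell2_apply f x))\<^sup>2 = 0" for x
      unfolding inner_ell2_self
      using ell2_apply[of f] by (intro nonneg_infsum_le_0D[where A=UNIV]) (auto simp: square_summable_def)
    then show "f = 0" by transfer auto
  next
    assume "f = 0"
    then show "inner f f = 0" unfolding inner_ell2_self by (simp add: zero_ell2.rep_eq)
  qed
qed

end

lemma norm_ell2_square: "(norm f)\<^sup>2 = (\<Sum>\<^sub>\<infinity>x. (norm (ell2_apply f x))\<^sup>2)"
  by (simp add: power2_norm_eq_inner inner_ell2_self)

lemma ell2_finite_sum_le: "finite F \<Longrightarrow> (\<Sum>x\<in>F. (norm (ell2_apply f x))\<^sup>2) \<le> (norm f)\<^sup>2"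
  unfolding norm_ell2_square
  using ell2_apply[of f] by (intro finite_sum_le_infsum) (auto simp: square_summable_def)

lemma norm_ell2_leI:
  assumes "\<And>F. finite F \<Longrightarrow> (\<Sum>x\<in>F. (norm (ell2_apply f x))\<^sup>2) \<le> C\<^sup>2" "0 \<le> C"
  shows "norm f \<le> C"
proof (rule power2_le_imp_le)
  show "(norm f)\<^sup>2 \<le> C\<^sup>2"
    unfolding norm_ell2_square
    using ell2_apply[of f] assms(1) by (intro infsum_le_finite_sums) (auto simp: square_summable_def)
qed (rule assms)

lemma norm_ell2_apply_le: "norm (ell2_apply f x) \<le> norm f"
  using ell2_finite_sum_le[of "{x}" f] by (auto intro: power2_le_imp_le)

instance ell2 :: (type, complex_hilbert) banach
proof
  fix X :: "nat \<Rightarrow> ('a, 'b) ell2"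
  assume X: "Cauchy X"
  have cauchy: "Cauchy (\<lambda>n. ell2_apply (X n) x)" for x
    unfolding Cauchy_def
  proof (intro allI impI)
    fix e :: real assume "0 < e"
    then obtain N where N: "\<And>m n. m \<ge> N \<Longrightarrow> n \<ge> N \<Longrightarrow> dist (X m) (X n) < e"
      using X unfolding Cauchy_def by blast
    have "dist (ell2_apply (X m) x) (ell2_apply (X n) x) \<le> dist (X m) (X n)" for m n
      using norm_ell2_apply_le[of "X m - X n" x] by (simp add: dist_norm minus_ell2.rep_eq)
    then show "\<exists>N. \<forall>m\<ge>N. \<forall>n\<ge>N. dist (ell2_apply (X m) x) (ell2_apply (X n) x) < e"
      using N by (meson le_less_trans)
  qed
  define l where "l x = lim (\<lambda>n. ell2_apply (X n) x)" for x
  have l: "(\<lambda>n. ell2_apply (X n) x) \<longlonglongrightarrow> l x" for x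
    using Cauchy_convergent[OF cauchy, of x]
    by (simp add: l_def convergent_LIMSEQ_iff)
  have tail: "\<exists>N. \<forall>n\<ge>N. \<forall>F. finite F \<longrightarrow> (\<Sum>x\<in>F. (norm (ell2_apply (X n) x - l x))\<^sup>2) \<le> e\<^sup>2"
    if e: "e > 0" for e
  proof -
    obtain N where N: "\<And>m n. m \<ge> N \<Longrightarrow> n \<ge> N \<Longrightarrow> norm (X n - X m) < e"
      using X e unfolding Cauchy_def dist_norm by blast
    have "(\<Sum>x\<in>F. (norm (ell2_apply (X n) x - l x))\<^sup>2) \<le> e\<^sup>2" if n: "n \<ge> N" and F: "finite F" for n F
    proof (rule tendsto_upperbound)
      show "(\<lambda>m. \<Sum>x\<in>F. (norm (ell2_apply (X n) x - ell2_apply (X m) x))\<^sup>2)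
        \<longlonglongrightarrow> (\<Sum>x\<in>F. (norm (ell2_apply (X n) x - l x))\<^sup>2)"
        by (intro tendsto_intros l)
      show "\<forall>\<^sub>F m in sequentially. (\<Sum>x\<in>F. (norm (ell2_apply (X n) x - ell2_apply (X m) x))\<^sup>2) \<le> e\<^sup>2"
        unfolding eventually_sequentially
      proof (intro exI allI impI)
        fix m assume m: "m \<ge> N"
        have "(\<Sum>x\<in>F. (norm (ell2_apply (X n - X m) x))\<^sup>2) \<le> (norm (X n - X m))\<^sup>2"
          by (rule ell2_finite_sum_le[OF F])
        also have "\<dots> \<le> e\<^sup>2"
          using N[OF m n] by (intro power_mono) auto
        finally show "(\<Sum>x\<in>F. (norm (ell2_apply (X n) x - ell2_apply (X m) x))\<^sup>2) \<le> e\<^sup>2"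
          by (simp add: minus_ell2.rep_eq)
      qed
    qed simp
    then show ?thesis by blast
  qed
  obtain N where N: "\<And>F. finite F \<Longrightarrow> (\<Sum>x\<in>F. (norm (ell2_apply (X N) x - l x))\<^sup>2) \<le> 1\<^sup>2"
    using tail[of 1] by auto
  have "square_summable (\<lambda>x. l x - ell2_apply (X N) x)"
    by (rule square_summable_boundedI[where C="1\<^sup>2"]) (use N in \<open>simp add: norm_minus_commute\<close>)
  from square_summable_add[OF this, of "ell2_apply (X N)"]
  have "square_summable l" using ell2_apply[of "X N"] by simp
  then have L: "ell2_apply (Abs_ell2 l) = l" by (simp add: Abs_ell2_inverse)
  have "X \<longlonglongrightarrow> Abs_ell2 l"
  proof (rule metric_LIMSEQ_I)
    fix r :: real assume "0 < r"
    then obtain N where N: "\<And>n F. n \<ge> N \<Longrightarrow> finite F \<Longrightarrow>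
        (\<Sum>x\<in>F. (norm (ell2_apply (X n) x - l x))\<^sup>2) \<le> (r/2)\<^sup>2"
      using tail[of "r/2"] by auto
    have "norm (X n - Abs_ell2 l) \<le> r/2" if "n \<ge> N" for n
      using N[OF that] \<open>0 < r\<close> by (intro norm_ell2_leI) (auto simp: minus_ell2.rep_eq L)
    then show "\<exists>no. \<forall>n\<ge>no. dist (X n) (Abs_ell2 l) < r"
      using \<open>0 < r\<close> unfolding dist_norm by (intro exI[of _ N]) fastforce
  qed
  then show "convergent X" by (auto simp: convergent_def)
qed

instantiation ell2 :: (type, complex_hilbert) complex_hilbert
begin

lift_definition scaleC_ell2 :: "complex \<Rightarrow> ('a, 'b) ell2 \<Rightarrow> ('a, 'b) ell2" is "\<lambda>a f x. a *\<^sub>C f x"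
  by (rule square_summable_bounded) (auto simp: norm_scaleC)

lift_definition cinner_ell2 :: "('a, 'b) ell2 \<Rightarrow> ('a, 'b) ell2 \<Rightarrow> complex"
  is "\<lambda>f g. \<Sum>\<^sub>\<infinity>x. cinner (f x) (g x)" .

instance
proof
  fix f g h :: "('a, 'b) ell2" and a b :: complex and r :: real
  show "a *\<^sub>C (f + g) = a *\<^sub>C f + a *\<^sub>C g" "(a + b) *\<^sub>C f = a *\<^sub>C f + b *\<^sub>C f"
    "a *\<^sub>C b *\<^sub>C f = (a * b) *\<^sub>C f" "complex_of_real r *\<^sub>C f = r *\<^sub>R f"
    by (transfer; simp add: scaleC_add_right scaleC_add_left scaleC_scaleC scaleC_of_real)+
  show "cinner f g = cnj (cinner g f)"
    by transfer (subst infsum_cnj[symmetric], rule infsum_cong, rule cinner_commute)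
  show "cinner (f + g) h = cinner f h + cinner g h"
    by transfer (simp add: cinner_add_left infsum_add cinner_summable)
  show "cinner (a *\<^sub>C f) g = a * cinner f g"
    by transfer (simp add: cinner_scaleC_left infsum_cmult_right')
  show "inner f g = Re (cinner f g)"
    by transfer simp
qed

end


section \<open>Bounded operators\<close>

text \<open>
  The library type of bounded linear maps is about real-linear maps; a bounded operator is one that
  is complex linear.  The norm of that type is the operator norm.
\<close>

definition bounded_operators :: "('a::complex_hilbert \<Rightarrow>\<^sub>L 'b::complex_hilbert) set"
  where "bounded_operators = {A :: 'a \<Rightarrow>\<^sub>L 'b. \<forall>c f. A (c *\<^sub>C f) = c *\<^sub>C A f}"

definition spectrum :: "('h::complex_hilbert \<Rightarrow>\<^sub>L 'h) \<Rightarrow> complex set"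
  where "spectrum A = {z. \<not> (\<exists>B :: 'h \<Rightarrow>\<^sub>L 'h. B \<in> bounded_operators \<and>
           (\<forall>f. B (A f - z *\<^sub>C f) = f \<and> A (B f) - z *\<^sub>C B f = f))}"

definition closed_numerical_range :: "('h::complex_hilbert \<Rightarrow>\<^sub>L 'h) \<Rightarrow> complex set"
  where "closed_numerical_range A = closure {cinner (A f) f | f. norm f = 1}"

text \<open>The operator \<open>B\<close> below is the adjoint of \<open>A\<close>, which the inner product identity determines.\<close>

definition normal_operator :: "('h::complex_hilbert \<Rightarrow>\<^sub>L 'h) \<Rightarrow> bool"
  where "normal_operator A \<longleftrightarrow> (\<exists>B :: 'h \<Rightarrow>\<^sub>L 'h. B \<in> bounded_operators \<and>
           (\<forall>f g. cinner (A f) g = cinner f (B g)) \<and> A o\<^sub>L B = B o\<^sub>L A)"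

definition closed_convex_hull :: "complex set \<Rightarrow> complex set"
  where "closed_convex_hull S = closure (convex hull S)"

definition family_spectrum :: "('h::complex_hilbert \<Rightarrow>\<^sub>L 'h) set \<Rightarrow> complex set"
  where "family_spectrum M = closure (\<Union>A\<in>M. spectrum A)"

definition family_numerical_range :: "('h::complex_hilbert \<Rightarrow>\<^sub>L 'h) set \<Rightarrow> complex set"
  where "family_numerical_range M = closure (\<Union>A\<in>M. closed_numerical_range A)"

lemma bounded_operators_scaleC: "A \<in> bounded_operators \<Longrightarrow> A (c *\<^sub>C f) = c *\<^sub>C A f"
  by (simp add: bounded_operators_def)


section \<open>Translations and potentials\<close>

definition translation ::
  "('g, 'm) monoid_scheme \<Rightarrow> ('g \<Rightarrow> 'x \<Rightarrow> 'x) \<Rightarrow> 'g \<Rightarrow> ('x, 'k::complex_hilbert) ell2 \<Rightarrow>\<^sub>L ('x, 'k) ell2"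
  where "translation G \<phi> \<gamma> = Blinfun (\<lambda>f. Abs_ell2 (\<lambda>x. ell2_apply f (\<phi> (inv\<^bsub>G\<^esub> \<gamma>) x)))"

definition potential_operator ::
  "('x \<Rightarrow> 'k \<Rightarrow>\<^sub>L 'k) \<Rightarrow> ('x, 'k::complex_hilbert) ell2 \<Rightarrow>\<^sub>L ('x, 'k) ell2"
  where "potential_operator V = Blinfun (\<lambda>f. Abs_ell2 (\<lambda>x. V x (ell2_apply f x)))"

definition pseudo_ergodic ::
  "('g, 'm) monoid_scheme \<Rightarrow> ('g \<Rightarrow> 'x \<Rightarrow> 'x) \<Rightarrow> ('k::complex_hilbert \<Rightarrow>\<^sub>L 'k) set
    \<Rightarrow> ('x \<Rightarrow> 'k \<Rightarrow>\<^sub>L 'k) \<Rightarrow> bool"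
  where "pseudo_ergodic G \<phi> M V \<longleftrightarrow> range V \<subseteq> M \<and>
    (\<forall>\<epsilon>>0. \<forall>F W. finite F \<and> W ` F \<subseteq> M \<longrightarrow>
       (\<exists>\<gamma>\<in>carrier G. \<forall>x\<in>F. norm (W x - V (\<phi> \<gamma> x)) < \<epsilon>))"

text \<open>
  The operators above are made from plain functions with \<^const>\<open>Abs_ell2\<close> and \<^const>\<open>Blinfun\<close>;
  the next two lemmas show that they act as intended.
\<close>

lemma translation_apply:
  fixes f :: "('x, 'k::complex_hilbert) ell2"
  assumes "group_action G UNIV \<phi>" "\<gamma> \<in> carrier G"
  shows "ell2_apply (translation G \<phi> \<gamma> f) x = ell2_apply f (\<phi> (inv\<^bsub>G\<^esub> \<gamma>) x)"
proof -
  interpret group_action G UNIV \<phi> by fact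
  interpret group G using group_hom by (rule group_hom.axioms)
  define p where "p = \<phi> (inv\<^bsub>G\<^esub> \<gamma>)"
  have "inv\<^bsub>G\<^esub> \<gamma> \<in> carrier G" using assms(2) by simp
  then have p: "bij p"
    using bij_prop0 by (auto simp: p_def Bij_def)
  have reindex: "((\<lambda>x. u (p x)) summable_on UNIV) = (u summable_on UNIV)"
    "(\<Sum>\<^sub>\<infinity>x. u (p x)) = (\<Sum>\<^sub>\<infinity>x. u x)" for u :: "'x \<Rightarrow> real"
    using p by (rule summable_on_reindex_bij_betw, rule infsum_reindex_bij_betw)
  have ss: "square_summable (\<lambda>x. ell2_apply f (p x))" for f :: "('x, 'k) ell2"
    using ell2_apply[of f] reindex(1)[of "\<lambda>x. (norm (ell2_apply f x))\<^sup>2"]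
    by (simp add: square_summable_def)
  have ap: "ell2_apply (Abs_ell2 (\<lambda>x. ell2_apply f (p x))) y = ell2_apply f (p y)"
    for f :: "('x, 'k) ell2" and y
    using ss[of f] by (simp add: Abs_ell2_inverse)
  have "bounded_linear (\<lambda>f :: ('x, 'k) ell2. Abs_ell2 (\<lambda>x. ell2_apply f (p x)))"
  proof (rule bounded_linear_intro[where K=1])
    fix f :: "('x, 'k) ell2"
    have "(norm (Abs_ell2 (\<lambda>x. ell2_apply f (p x))))\<^sup>2 = (norm f)\<^sup>2"
      unfolding norm_ell2_square ap by (rule reindex)
    then show "norm (Abs_ell2 (\<lambda>x. ell2_apply f (p x))) \<le> norm f * 1" by simp
  qed (rule ell2_eqI, simp only: ap,
      simp add: ap plus_ell2.rep_eq scaleR_ell2.rep_eq)+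
  then show ?thesis
    unfolding translation_def p_def[symmetric] by (simp add: bounded_linear_Blinfun_apply ap)
qed

lemma potential_operator_apply:
  fixes V :: "'x \<Rightarrow> 'k \<Rightarrow>\<^sub>L 'k::complex_hilbert"
  assumes "bounded (range V)"
  shows "ell2_apply (potential_operator V f) x = V x (ell2_apply f x)"
proof -
  obtain C where C: "\<And>x. norm (V x) \<le> C"
    using assms by (auto simp: bounded_iff)
  have le: "norm (V x k) \<le> C * norm k" for x k
    by (rule order_trans[OF norm_blinfun]) (simp add: C mult_right_mono)
  have C0: "0 \<le> C" using C norm_ge_zero order_trans by blast
  have ap: "ell2_apply (Abs_ell2 (\<lambda>x. V x (ell2_apply f x))) y = V y (ell2_apply f y)" for f y
    using square_summable_bounded[of "ell2_apply f" "\<lambda>x. V x (ell2_apply f x)" C] ell2_apply[of f] le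
    by (simp add: Abs_ell2_inverse)
  have "bounded_linear (\<lambda>f. Abs_ell2 (\<lambda>x. V x (ell2_apply f x)))"
  proof (rule bounded_linear_intro[where K=C])
    fix f
    show "norm (Abs_ell2 (\<lambda>x. V x (ell2_apply f x))) \<le> norm f * C"
    proof (rule norm_ell2_leI)
      fix F :: "'x set" assume F: "finite F"
      have "(\<Sum>x\<in>F. (norm (V x (ell2_apply f x)))\<^sup>2) \<le> (\<Sum>x\<in>F. C\<^sup>2 * (norm (ell2_apply f x))\<^sup>2)"
        by (rule sum_mono) (auto simp flip: power_mult_distrib intro!: power_mono le)
      also have "\<dots> = C\<^sup>2 * (\<Sum>x\<in>F. (norm (ell2_apply f x))\<^sup>2)"
        by (simp add: sum_distrib_left)
      also have "\<dots> \<le> C\<^sup>2 * (norm f)\<^sup>2"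
        by (intro mult_left_mono ell2_finite_sum_le F) simp
      finally show "(\<Sum>x\<in>F. (norm (ell2_apply (Abs_ell2 (\<lambda>x. V x (ell2_apply f x))) x))\<^sup>2) \<le> (norm f * C)\<^sup>2"
        unfolding ap by (simp add: power_mult_distrib mult.commute)
    qed (simp add: C0)
  qed (rule ell2_eqI, simp only: ap,
      simp add: ap plus_ell2.rep_eq scaleR_ell2.rep_eq blinfun.add_right blinfun.scaleR_right)+
  then show ?thesis
    unfolding potential_operator_def by (simp add: bounded_linear_Blinfun_apply ap)
qed


section \<open>Tensoring an operator with the identity\<close>

lift_definition tensor_ell2 :: "('x, complex) ell2 \<Rightarrow> 'k::complex_hilbert \<Rightarrow> ('x, 'k) ell2"
  is "\<lambda>g k x. g x *\<^sub>C k"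
  by (rule square_summable_bounded) (auto simp: norm_scaleC mult.commute)

definition tensor_identity ::
  "(('x, complex) ell2 \<Rightarrow>\<^sub>L ('x, complex) ell2)
    \<Rightarrow> (('x, 'k::complex_hilbert) ell2 \<Rightarrow>\<^sub>L ('x, 'k) ell2)"
  where "tensor_identity H =
    (THE T. T \<in> bounded_operators \<and> (\<forall>g k. T (tensor_ell2 g k) = tensor_ell2 (H g) k))"

text \<open>
  The description is proper: \<open>tensor_identity_ex1\<close> below.  Existence is shown by summing the columns
  of \<open>H\<close>, tensored with the values of the argument.
\<close>

lift_definition single_ell2 :: "'x \<Rightarrow> 'k \<Rightarrow> ('x, 'k::complex_hilbert) ell2"
  is "\<lambda>y k x. if x = y then k else 0"
proof -
  fix y :: 'x and k :: 'k
  have "(norm (if x = y then k else 0))\<^sup>2 = (if x = y then (norm k)\<^sup>2 else 0)" for x :: 'x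
    by simp
  then show "square_summable (\<lambda>x. if x = y then k else 0)"
    by (intro square_summable_boundedI[where C="(norm k)\<^sup>2"]) simp
qed

lemma ell2_apply_sum: "ell2_apply (\<Sum>y\<in>F. f y) x = (\<Sum>y\<in>F. ell2_apply (f y) x)"
  by (induction F rule: infinite_finite_induct) (auto simp: zero_ell2.rep_eq plus_ell2.rep_eq)

lemma norm_tensor_ell2: "norm (tensor_ell2 g k) = norm g * norm k"
proof -
  have "(norm (tensor_ell2 g k))\<^sup>2 = (norm g * norm k)\<^sup>2"
    unfolding norm_ell2_square power_mult_distrib
    by (simp add: tensor_ell2.rep_eq norm_scaleC power_mult_distrib infsum_cmult_left')
  then show ?thesis by simp
qed

lemma scaleC_zero_right [simp]: "a *\<^sub>C (0 :: 'k::complex_hilbert) = 0"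
  using norm_scaleC[of a "0 :: 'k"] by simp

lemma scaleC_sum_right: "a *\<^sub>C (\<Sum>y\<in>F. f y) = (\<Sum>y\<in>F. a *\<^sub>C (f y :: 'k::complex_hilbert))"
  by (induction F rule: infinite_finite_induct) (auto simp: scaleC_add_right)

lemma scaleC_sum_left: "(\<Sum>y\<in>F. a y) *\<^sub>C (k :: 'k::complex_hilbert) = (\<Sum>y\<in>F. a y *\<^sub>C k)"
  using scaleC_of_real[of 0 k] by (induction F rule: infinite_finite_induct) (auto simp: scaleC_add_left)

lemma cinner_zero_left [simp]: "cinner (0 :: 'k::complex_hilbert) k = 0"
  using cinner_add_left[of 0 0 k] by simp

lemma cinner_sum_left: "cinner (\<Sum>y\<in>F. f y) (k :: 'k::complex_hilbert) = (\<Sum>y\<in>F. cinner (f y) k)"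
  by (induction F rule: infinite_finite_induct) (auto simp: cinner_add_left)

lemma tensor_single: "tensor_ell2 (single_ell2 y a) k = single_ell2 y (a *\<^sub>C k)"
  using scaleC_of_real[of 0 k]
  by (intro ell2_eqI) (simp add: tensor_ell2.rep_eq single_ell2.rep_eq)

lemma norm_ell2_finite_support:
  assumes "finite F"
  shows "(norm (\<Sum>y\<in>F. single_ell2 y (k y)))\<^sup>2 = (\<Sum>y\<in>F. (norm (k y))\<^sup>2)"
proof -
  have ap: "ell2_apply (\<Sum>y\<in>F. single_ell2 y (k y)) x = (if x \<in> F then k x else 0)" for x
    using assms by (simp add: ell2_apply_sum single_ell2.rep_eq)
  have "((\<lambda>x. (norm (if x \<in> F then k x else 0))\<^sup>2) has_sum (\<Sum>y\<in>F. (norm (k y))\<^sup>2)) UNIV"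
    by (rule has_sum_finite_neutralI[where B=F]) (auto simp: assms)
  then show ?thesis
    unfolding norm_ell2_square ap by (rule infsumI)
qed

lemma has_sum_singles: "((\<lambda>y. single_ell2 y (ell2_apply f y)) has_sum f) UNIV"
  unfolding has_sum_def
proof (rule Lim_null[THEN iffD2], rule tendsto_norm_zero_cancel)
  define S where "S = (\<lambda>F. (norm f)\<^sup>2 - (\<Sum>y\<in>F. (norm (ell2_apply f y))\<^sup>2))"
  have "((\<lambda>y. (norm (ell2_apply f y))\<^sup>2) has_sum (norm f)\<^sup>2) UNIV"
    using ell2_apply[of f] by (simp add: norm_ell2_square square_summable_def)
  then have "(S \<longlongrightarrow> (norm f)\<^sup>2 - (norm f)\<^sup>2) (finite_subsets_at_top UNIV)"
    unfolding S_def has_sum_def by (intro tendsto_diff tendsto_const)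
  then have "((\<lambda>F. sqrt (S F)) \<longlongrightarrow> sqrt 0) (finite_subsets_at_top UNIV)"
    by (intro tendsto_real_sqrt) simp
  moreover have "norm ((\<Sum>y\<in>F. single_ell2 y (ell2_apply f y)) - f) = sqrt (S F)" if F: "finite F" for F
  proof -
    have sm: "(\<lambda>x. (norm (ell2_apply f x))\<^sup>2) summable_on A" for A
      using ell2_apply[of f] by (auto simp: square_summable_def intro: summable_on_subset_banach)
    have "(norm ((\<Sum>y\<in>F. single_ell2 y (ell2_apply f y)) - f))\<^sup>2
        = (\<Sum>\<^sub>\<infinity>x\<in>UNIV - F. (norm (ell2_apply f x))\<^sup>2)"
      unfolding norm_ell2_square
      by (rule infsum_cong_neutral) (auto simp: minus_ell2.rep_eq ell2_apply_sum single_ell2.rep_eq F)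
    also have "\<dots> = S F"
      unfolding S_def norm_ell2_square using F by (subst infsum_Diff) (auto simp: sm)
    finally show ?thesis by (metis norm_ge_zero real_sqrt_unique)
  qed
  then have "\<forall>\<^sub>F F in finite_subsets_at_top UNIV.
      sqrt (S F) = norm ((\<Sum>y\<in>F. single_ell2 y (ell2_apply f y)) - f)"
    by (intro eventually_finite_subsets_at_top_weakI) simp
  ultimately show "((\<lambda>F. norm ((\<Sum>y\<in>F. single_ell2 y (ell2_apply f y)) - f)) \<longlongrightarrow> 0)
      (finite_subsets_at_top UNIV)"
    using Lim_transform_eventually[of "\<lambda>F. sqrt (S F)"] by simp
qed

lemma norm_columns_le:
  fixes H :: "('x, complex) ell2 \<Rightarrow>\<^sub>L ('x, complex) ell2" and k :: "'x \<Rightarrow> 'k::complex_hilbert"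
  assumes H: "H \<in> bounded_operators" and F: "finite F"
  shows "(norm (\<Sum>y\<in>F. tensor_ell2 (H (single_ell2 y 1)) (k y)))\<^sup>2 \<le> (norm H)\<^sup>2 * (\<Sum>y\<in>F. (norm (k y))\<^sup>2)"
proof (induction "card {y\<in>F. k y \<noteq> 0}" arbitrary: k rule: less_induct)
  case less
  show ?case
  proof (cases "\<exists>y0\<in>F. k y0 \<noteq> 0")
    case False
    have "tensor_ell2 g (0 :: 'k) = 0" for g :: "('x, complex) ell2"
      using norm_tensor_ell2[of g "0 :: 'k"] by simp
    then have "(\<Sum>y\<in>F. tensor_ell2 (H (single_ell2 y 1)) (k y)) = 0"
      using False by (intro sum.neutral) auto
    then show ?thesis by (simp add: sum_nonneg)
  next
    case True
    then obtain y0 where y0: "y0 \<in> F" "k y0 \<noteq> 0" by blast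
    define u where "u = k y0 /\<^sub>R norm (k y0)"
    have nu: "norm u = 1" using y0 by (simp add: u_def)
    have uu: "cinner u u = 1" using nu by (simp add: cinner_self)
    define a where "a y = cinner (k y) u" for y
    define k' where "k' y = k y - a y *\<^sub>C u" for y
    have k: "k y = a y *\<^sub>C u + k' y" for y by (simp add: k'_def)
    have orth: "cinner (k' y) u = 0" for y
    proof -
      have "cinner (k y) u = a y * cinner u u + cinner (k' y) u"
        by (subst k) (simp add: cinner_add_left cinner_scaleC_left)
      then show ?thesis by (simp add: a_def uu)
    qed
    have pyth: "(norm (b *\<^sub>C u + w))\<^sup>2 = (cmod b)\<^sup>2 + (norm w)\<^sup>2" if "cinner w u = 0" for b w
    proof -
      have "inner w (b *\<^sub>C u) = 0"
        by (simp add: inner_eq_Re_cinner cinner_scaleC_right that)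
      then have "inner (b *\<^sub>C u) w = 0" by (simp add: inner_commute)
      then show ?thesis
        using dot_norm[of "b *\<^sub>C u" w] by (simp add: norm_scaleC nu)
    qed
    have "k' y0 = 0"
    proof -
      have ku: "k y0 = complex_of_real (norm (k y0)) *\<^sub>C u"
        using y0 by (simp add: scaleC_of_real u_def)
      have "a y0 = complex_of_real (norm (k y0))"
        unfolding a_def by (subst ku) (simp add: cinner_scaleC_left uu)
      then have "a y0 *\<^sub>C u = k y0" by (simp only: ku[symmetric])
      then show ?thesis by (simp only: k'_def diff_self)
    qed
    moreover have "k' y = 0" if "k y = 0" for y
      using that scaleC_of_real[of 0 u] by (simp add: k'_def a_def)
    ultimately have "{y\<in>F. k' y \<noteq> 0} \<subset> {y\<in>F. k y \<noteq> 0}"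
      using y0 by auto
    then have "card {y\<in>F. k' y \<noteq> 0} < card {y\<in>F. k y \<noteq> 0}"
      using F by (intro psubset_card_mono) auto
    note IH = less[OF this]
    define h where "h = (\<Sum>y\<in>F. single_ell2 y (a y))"
    define T where "T = (\<Sum>y\<in>F. tensor_ell2 (H (single_ell2 y 1)) (k y))"
    define T' where "T' = (\<Sum>y\<in>F. tensor_ell2 (H (single_ell2 y 1)) (k' y))"
    have "H (single_ell2 y (a y)) = a y *\<^sub>C H (single_ell2 y 1)" for y
    proof -
      have "single_ell2 y (a y) = a y *\<^sub>C single_ell2 y 1"
        by (rule ell2_eqI) (simp add: single_ell2.rep_eq scaleC_ell2.rep_eq scaleC_complex_def)
      then show ?thesis using H by (simp add: bounded_operators_scaleC)
    qed
    then have Hh: "ell2_apply (H h) x = (\<Sum>y\<in>F. a y * ell2_apply (H (single_ell2 y 1)) x)" for x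
      by (simp add: h_def blinfun.sum_right ell2_apply_sum scaleC_ell2.rep_eq scaleC_complex_def)
    have T: "ell2_apply T x = ell2_apply (H h) x *\<^sub>C u + ell2_apply T' x" for x
      unfolding T_def T'_def Hh ell2_apply_sum tensor_ell2.rep_eq k
      by (simp add: scaleC_add_right sum.distrib scaleC_sum_left scaleC_scaleC mult.commute)
    have T'u: "cinner (ell2_apply T' x) u = 0" for x
      by (simp add: T'_def ell2_apply_sum tensor_ell2.rep_eq cinner_sum_left cinner_scaleC_left orth)
    have "(norm T)\<^sup>2 = (norm (H h))\<^sup>2 + (norm T')\<^sup>2"
      unfolding norm_ell2_square T pyth[OF T'u]
      using ell2_apply[of "H h"] ell2_apply[of T']
      by (intro infsum_add) (auto simp: square_summable_def)
    also have "\<dots> \<le> (norm H)\<^sup>2 * (norm h)\<^sup>2 + (norm H)\<^sup>2 * (\<Sum>y\<in>F. (norm (k' y))\<^sup>2)"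
      using IH power_mono[OF norm_blinfun[of H h] norm_ge_zero, of 2]
      by (intro add_mono) (auto simp: T'_def power_mult_distrib)
    also have "(norm h)\<^sup>2 = (\<Sum>y\<in>F. (cmod (a y))\<^sup>2)"
      unfolding h_def by (rule norm_ell2_finite_support[OF F])
    also have "(norm H)\<^sup>2 * (\<Sum>y\<in>F. (cmod (a y))\<^sup>2) + (norm H)\<^sup>2 * (\<Sum>y\<in>F. (norm (k' y))\<^sup>2)
        = (norm H)\<^sup>2 * (\<Sum>y\<in>F. (norm (k y))\<^sup>2)"
      unfolding k pyth[OF orth] by (simp add: sum.distrib distrib_left)
    finally show ?thesis by (simp add: T_def)
  qed
qed

lemma summable_on_square_norm:
  fixes f :: "'x \<Rightarrow> 'b::banach"
  assumes g: "g summable_on UNIV" and le: "\<And>F. finite F \<Longrightarrow> (norm (sum f F))\<^sup>2 \<le> sum g F"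
  shows "f summable_on UNIV"
proof -
  from g obtain L where L: "(sum g \<longlongrightarrow> L) (finite_subsets_at_top UNIV)"
    unfolding has_sum_def summable_on_def by blast
  have "\<exists>P. eventually P (finite_subsets_at_top UNIV) \<and>
      (\<forall>F F'. P F \<and> P F' \<longrightarrow> dist (sum f F) (sum f F') < e)" if e: "e > 0" for e
  proof -
    have "\<forall>\<^sub>F F in finite_subsets_at_top UNIV. dist (sum g F) L < (e/2)\<^sup>2 / 2"
      using e by (intro tendstoD[OF L]) simp
    then obtain F0 where F0: "finite F0"
      "\<And>F. finite F \<Longrightarrow> F0 \<subseteq> F \<Longrightarrow> dist (sum g F) L < (e/2)\<^sup>2 / 2"
      unfolding eventually_finite_subsets_at_top by auto
    have near: "norm (sum f F - sum f F0) < e/2" if F: "finite F" "F0 \<subseteq> F" for F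
    proof -
      have "(norm (sum f F - sum f F0))\<^sup>2 = (norm (sum f (F - F0)))\<^sup>2"
        using F by (simp add: sum_diff)
      also have "\<dots> \<le> sum g (F - F0)" using F by (intro le) auto
      also have "\<dots> = sum g F - sum g F0" using F by (simp add: sum_diff)
      also have "\<dots> < (e/2)\<^sup>2"
        using F0(2)[OF F] F0(2)[OF F0(1) order_refl] by (simp only: dist_real_def abs_less_iff) linarith
      finally show ?thesis using e by (intro power_less_imp_less_base[of _ 2 "e/2"]) auto
    qed
    have "dist (sum f F) (sum f F') < e"
      if "finite F" "F0 \<subseteq> F" "finite F'" "F0 \<subseteq> F'" for F F'
      using near[OF that(1,2)] near[OF that(3,4)]
        dist_triangle2[of "sum f F" "sum f F'" "sum f F0"] by (simp add: dist_norm)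
    then show ?thesis
      using F0(1) by (intro exI[of _ "\<lambda>F. finite F \<and> F0 \<subseteq> F"])
        (auto simp: eventually_finite_subsets_at_top)
  qed
  then have "cauchy_filter (filtermap (sum f) (finite_subsets_at_top UNIV))"
    by (simp add: cauchy_filter_metric_filtermap)
  moreover have "complete (UNIV :: 'b set)"
    by (meson Cauchy_convergent UNIV_I complete_def convergent_def)
  ultimately obtain L' where "(sum f \<longlongrightarrow> L') (finite_subsets_at_top UNIV)"
    using complete_uniform[where S=UNIV] by (force simp add: filterlim_def)
  then show ?thesis
    using summable_on_def has_sum_def by blast
qed

lemma bounded_linear_tensor_ell2_left: "bounded_linear (\<lambda>g. tensor_ell2 g k)"
  by (rule bounded_linear_intro[where K="norm k"])
    (auto intro!: ell2_eqI simp: norm_tensor_ell2 tensor_ell2.rep_eq plus_ell2.rep_eq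
      scaleR_ell2.rep_eq scaleC_add_left scaleR_conv_of_real scaleC_scaleC[symmetric] scaleC_of_real)

lemma bounded_linear_scaleC: "bounded_linear (\<lambda>k :: 'k::complex_hilbert. a *\<^sub>C k)"
proof (rule bounded_linear_intro[where K="cmod a"])
  show "a *\<^sub>C r *\<^sub>R k = r *\<^sub>R a *\<^sub>C k" for r and k :: 'k
    by (simp add: scaleC_of_real[symmetric] scaleC_scaleC mult.commute)
qed (auto simp: scaleC_add_right norm_scaleC mult.commute)

theorem tensor_identity_ex1:
  fixes H :: "('x, complex) ell2 \<Rightarrow>\<^sub>L ('x, complex) ell2"
  assumes H: "H \<in> bounded_operators"
  shows "\<exists>!T :: ('x, 'k::complex_hilbert) ell2 \<Rightarrow>\<^sub>L ('x, 'k) ell2.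
    T \<in> bounded_operators \<and> (\<forall>g k. T (tensor_ell2 g k) = tensor_ell2 (H g) k)"
proof -
  define c where "c f y = tensor_ell2 (H (single_ell2 y 1)) (ell2_apply f y)"
    for f :: "('x, 'k) ell2" and y
  have le: "(norm (\<Sum>y\<in>F. c f y))\<^sup>2 \<le> (\<Sum>y\<in>F. (norm H)\<^sup>2 * (norm (ell2_apply f y))\<^sup>2)"
    if "finite F" for F f
    using norm_columns_le[OF H that, of "ell2_apply f"] by (simp add: c_def sum_distrib_left)
  have sm: "c f summable_on UNIV" for f
  proof (rule summable_on_square_norm[OF _ le])
    show "(\<lambda>y. (norm H)\<^sup>2 * (norm (ell2_apply f y))\<^sup>2) summable_on UNIV"
      using ell2_apply[of f] by (intro summable_on_cmult_right) (simp add: square_summable_def)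
  qed
  have c_add: "c (f + g) y = c f y + c g y" for f g y
    by (rule ell2_eqI) (simp add: c_def tensor_ell2.rep_eq plus_ell2.rep_eq scaleC_add_right)
  have c_scaleC: "c (a *\<^sub>C f) y = a *\<^sub>C c f y" for a f y
    by (rule ell2_eqI)
      (simp add: c_def tensor_ell2.rep_eq scaleC_ell2.rep_eq scaleC_scaleC mult.commute)
  define T where "T f = (\<Sum>\<^sub>\<infinity>y. c f y)" for f
  have T_scaleC: "T (a *\<^sub>C f) = a *\<^sub>C T f" for a f
    unfolding T_def c_scaleC
    by (rule infsumI, rule has_sum_bounded_linear[OF bounded_linear_scaleC]) (simp add: sm)
  have bl: "bounded_linear T"
  proof (rule bounded_linear_intro[where K="norm H"])
    show "T (f + g) = T f + T g" for f g
      unfolding T_def c_add by (intro infsum_add sm)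
    show "T (r *\<^sub>R f) = r *\<^sub>R T f" for r f
      using T_scaleC[of "complex_of_real r" f] by (simp add: scaleC_of_real)
    show "norm (T f) \<le> norm f * norm H" for f
    proof (rule tendsto_upperbound)
      show "((\<lambda>F. norm (\<Sum>y\<in>F. c f y)) \<longlongrightarrow> norm (T f)) (finite_subsets_at_top UNIV)"
        using sm[of f] unfolding T_def by (intro tendsto_norm infsum_tendsto)
      show "\<forall>\<^sub>F F in finite_subsets_at_top UNIV. norm (\<Sum>y\<in>F. c f y) \<le> norm f * norm H"
      proof (rule eventually_finite_subsets_at_top_weakI)
        fix F :: "'x set" assume F: "finite F"
        have "(norm (\<Sum>y\<in>F. c f y))\<^sup>2 \<le> (norm H)\<^sup>2 * (\<Sum>y\<in>F. (norm (ell2_apply f y))\<^sup>2)"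
          using le[OF F] by (simp add: sum_distrib_left)
        also have "\<dots> \<le> (norm H)\<^sup>2 * (norm f)\<^sup>2"
          by (intro mult_left_mono ell2_finite_sum_le F) simp
        finally have "(norm (\<Sum>y\<in>F. c f y))\<^sup>2 \<le> (norm f * norm H)\<^sup>2"
          by (simp add: power_mult_distrib mult.commute)
        then show "norm (\<Sum>y\<in>F. c f y) \<le> norm f * norm H"
          by (rule power2_le_imp_le) simp
      qed
    qed simp
  qed
  have T_tensor: "T (tensor_ell2 g k) = tensor_ell2 (H g) k" for g k
  proof -
    have "bounded_linear (\<lambda>g. tensor_ell2 (H g) k)"
      by (rule bounded_linear_compose[OF bounded_linear_tensor_ell2_left])
        (rule blinfun.bounded_linear_right)
    from has_sum_bounded_linear[OF this has_sum_singles[of g]]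
    have "((\<lambda>y. tensor_ell2 (H (single_ell2 y (ell2_apply g y))) k) has_sum tensor_ell2 (H g) k) UNIV" .
    moreover have "tensor_ell2 (H (single_ell2 y (ell2_apply g y))) k = c (tensor_ell2 g k) y" for y
    proof -
      have "single_ell2 y (ell2_apply g y) = ell2_apply g y *\<^sub>C single_ell2 y 1"
        by (rule ell2_eqI) (simp add: single_ell2.rep_eq scaleC_ell2.rep_eq scaleC_complex_def)
      then show ?thesis
        by (intro ell2_eqI) (simp add: bounded_operators_scaleC[OF H] c_def tensor_ell2.rep_eq
            scaleC_ell2.rep_eq scaleC_scaleC scaleC_complex_def mult.commute)
    qed
    ultimately show ?thesis unfolding T_def by (simp add: infsumI)
  qed
  show ?thesis
  proof (rule ex1I[where a="Blinfun T"])
    show "Blinfun T \<in> bounded_operators \<and> (\<forall>g k. Blinfun T (tensor_ell2 g k) = tensor_ell2 (H g) k)"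
      by (simp add: bounded_operators_def bounded_linear_Blinfun_apply[OF bl] T_scaleC T_tensor)
  next
    fix T' :: "('x, 'k) ell2 \<Rightarrow>\<^sub>L ('x, 'k) ell2"
    assume T': "T' \<in> bounded_operators \<and> (\<forall>g k. T' (tensor_ell2 g k) = tensor_ell2 (H g) k)"
    show "T' = Blinfun T"
    proof (rule blinfun_eqI)
      fix f :: "('x, 'k) ell2"
      have one: "1 *\<^sub>C k = k" for k :: 'k
        using scaleC_of_real[of 1 k] by simp
      have "T' (single_ell2 y (ell2_apply f y)) = c f y" for y
        using T' tensor_single[of y 1 "ell2_apply f y"] unfolding c_def one by metis
      with has_sum_bounded_linear[OF blinfun.bounded_linear_right has_sum_singles, of T' f]
      have "(c f has_sum T' f) UNIV" by simp
      then show "T' f = Blinfun T f"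
        by (simp add: bounded_linear_Blinfun_apply[OF bl] T_def infsumI)
    qed
  qed
qed

end

theory Submission
  imports Defs
begin

text \<open>
  Everything rests on one description of the spectrum: \<open>z\<close> lies in the spectrum of \<open>A\<close> exactly
  when, for each \<open>\<epsilon> > 0\<close>, some unit vector \<open>g\<close> is an \<open>\<epsilon>\<close>-almost eigenvector, either of \<open>A\<close>
  itself (\<open>A g\<close> is within \<open>\<epsilon>\<close> of \<open>z g\<close>) or of the adjoint of \<open>A\<close>, expressed as
  \<open>\<bar>\<langle>(A - z) f, g\<rangle>\<bar> \<le> \<epsilon> \<parallel>f\<parallel>\<close> for all \<open>f\<close> (\<open>spectrum_iff_almost_eigenvectors\<close>).  It shows at once that
  the spectrum is closed and lies in the closed numerical range.

  Lower inclusion.  Fix \<open>A\<close> in \<open>M\<close> and let \<open>L = H0 \<otimes> I + I \<otimes> A\<close>.  If \<open>z\<close> and \<open>w\<close> are in the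
  spectra of \<open>H0\<close> and \<open>A\<close>, with almost eigenvectors \<open>g\<close> and \<open>k\<close>, put \<open>v = g \<otimes> k\<close>,
  \<open>a = (H0 - z) \<otimes> I\<close> and \<open>b = I \<otimes> (A - w)\<close>.  An inverse \<open>R\<close> of \<open>L - (z + w) = a + b\<close> would commute
  with \<open>a\<close> and \<open>b\<close>, and \<open>1 = \<langle>v, v\<rangle> = \<langle>a R v, v\<rangle> + \<langle>b R v, v\<rangle>\<close>; both terms are small, whichever
  kind of almost eigenvectors \<open>g\<close> and \<open>k\<close> are.  So \<open>z + w\<close> is in the spectrum of \<open>L\<close>
  (\<open>spectrum_sum_constant_potential\<close>).  An almost eigenvector of \<open>L\<close> is concentrated on a finite set,
  pseudo-ergodicity provides a translate of that set on which the potential is nearly constant with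
  value \<open>A\<close>, and \<open>H0\<close> commutes with translations; the translated vector is therefore an almost
  eigenvector of \<open>H\<close> (\<open>spectrum_constant_potential_subset\<close>).

  Upper inclusion.  The quadratic form of \<open>H\<close> at a unit vector \<open>f\<close> is the sum of that of
  \<open>H0 \<otimes> I\<close> and that of the potential.  A lower bound of the form of \<open>H0\<close> in some direction of the
  plane is inherited by \<open>H0 \<otimes> I\<close>, because \<open>f\<close> splits into orthogonal pieces \<open>g \<otimes> u\<close> whose
  images stay orthogonal; likewise a common bound for the operators \<open>V x\<close> is inherited by the potential.
  Closed convex sets are intersections of half planes, and the numerical range of \<open>H0\<close> is convex by
  the Toeplitz-Hausdorff theorem, so both summands lie where they should
  (\<open>spectrum_tensor_potential_subset\<close>).

  Normal operators.  The second upper bound follows from the first, since the numerical range of a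
  normal operator \<open>A\<close> lies in the closed convex hull of its spectrum.  A half plane is a limit of
  discs, so it suffices that each disc containing the spectrum contains the numerical range; after
  translation, that the normal operator \<open>N = A - c\<close> has a point of modulus \<open>\<parallel>N\<parallel>\<close> in its spectrum.
  Normality makes the norms of \<open>N\<^sup>j u\<close> log-convex in \<open>j\<close>, so a unit vector \<open>u\<close> with \<open>\<parallel>N u\<parallel>\<close> near
  \<open>\<parallel>N\<parallel>\<close> has orbit norms near \<open>\<parallel>N\<parallel>\<^sup>j\<close> for many \<open>j\<close>.  The discrete Fourier transform of the
  rescaled orbit then has, for some root of unity, norm at least \<open>\<surd>n / 2\<close>, while a telescoping
  sum shows that it is moved by the corresponding \<open>N - \<mu>\<close> only by \<open>2 \<parallel>N\<parallel>\<close>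
  (\<open>normal_operator_almost_eigenvector_on_circle\<close>).  Compactness of the circle concludes.
\<close>

section \<open>Complex inner products\<close>

lemma bounded_bilinear_cinner: "bounded_bilinear (cinner :: 'h::complex_hilbert \<Rightarrow> 'h \<Rightarrow> complex)"
proof
  fix x y :: 'h and r :: real
  show "cinner (r *\<^sub>R x) y = r *\<^sub>R cinner x y"
    by (simp add: scaleR_conv_of_real cinner_scaleC_left flip: scaleC_of_real[where x=x])
  show "cinner x (r *\<^sub>R y) = r *\<^sub>R cinner x y"
    by (simp add: scaleR_conv_of_real cinner_scaleC_right flip: scaleC_of_real[where x=y])
  show "\<exists>K. \<forall>a b :: 'h. norm (cinner a b) \<le> norm a * norm b * K"
    by (rule exI[of _ 1]) (simp add: cmod_cinner_le)
qed (simp_all add: cinner_add_left cinner_add_right)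

lemmas cinner_diff_left = bounded_bilinear.diff_left[OF bounded_bilinear_cinner]
lemmas cinner_diff_right = bounded_bilinear.diff_right[OF bounded_bilinear_cinner]
lemmas cinner_zero_right = bounded_bilinear.zero_right[OF bounded_bilinear_cinner]
lemmas cinner_sum_right = bounded_bilinear.sum_right[OF bounded_bilinear_cinner]

lemmas scaleC_diff_right = linear_diff[OF bounded_linear.linear[OF bounded_linear_scaleC]]
lemma scaleC_zero_left: "0 *\<^sub>C (k :: 'h::complex_hilbert) = 0"
  using scaleC_of_real[of 0 k] by simp

lemma scaleC_one: "1 *\<^sub>C (k :: 'h::complex_hilbert) = k"
  using scaleC_of_real[of 1 k] by simp

lemma scaleC_minus_left: "(- a) *\<^sub>C (k :: 'h::complex_hilbert) = - (a *\<^sub>C k)"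
  using scaleC_add_left[of "- a" a k] by (simp add: scaleC_zero_left add_eq_0_iff)

lemma scaleC_diff_left: "(a - b) *\<^sub>C (k :: 'h::complex_hilbert) = a *\<^sub>C k - b *\<^sub>C k"
  using scaleC_add_left[of a "- b" k] by (simp add: scaleC_minus_left)

lemma cinner_scaleR_left: "cinner (r *\<^sub>R x) (y :: 'h::complex_hilbert) = of_real r * cinner x y"
  by (simp add: scaleC_of_real[symmetric] cinner_scaleC_left)

lemma cinner_scaleR_right: "cinner x (r *\<^sub>R (y :: 'h::complex_hilbert)) = of_real r * cinner x y"
  by (simp add: scaleC_of_real[symmetric] cinner_scaleC_right)

text \<open>
  Pythagoras for the component of \<open>v\<close> orthogonal to \<open>s\<close>.
\<close>

lemma norm_minus_projection:
  fixes v s :: "'h::complex_hilbert"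
  assumes "s \<noteq> 0"
  shows "(norm (v - (cinner v s / of_real ((norm s)\<^sup>2)) *\<^sub>C s))\<^sup>2
    = (norm v)\<^sup>2 - (cmod (cinner v s))\<^sup>2 / (norm s)\<^sup>2"
proof -
  define c where "c = cinner v s / of_real ((norm s)\<^sup>2)"
  have n: "complex_of_real ((norm s)\<^sup>2) \<noteq> 0" using assms by simp
  have "complex_of_real ((norm (v - c *\<^sub>C s))\<^sup>2) = cinner (v - c *\<^sub>C s) (v - c *\<^sub>C s)"
    by (simp only: cinner_self)
  also have "\<dots> = cinner v v - cnj c * cinner v s - c * (cnj (cinner v s) - cnj c * cinner s s)"
    by (simp add: cinner_diff_left cinner_diff_right cinner_scaleC_left cinner_scaleC_right
        cinner_commute[of s v] algebra_simps)
  also have "cnj (cinner v s) - cnj c * cinner s s = 0"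
    using n by (simp add: c_def cinner_self)
  also have "cnj c * cinner v s = complex_of_real ((cmod (cinner v s))\<^sup>2 / (norm s)\<^sup>2)"
    using complex_norm_square[of "cinner v s"] by (simp add: c_def mult.commute)
  finally have "complex_of_real ((norm (v - c *\<^sub>C s))\<^sup>2)
      = complex_of_real ((norm v)\<^sup>2 - (cmod (cinner v s))\<^sup>2 / (norm s)\<^sup>2)"
    by (simp add: cinner_self)
  then show ?thesis unfolding c_def using of_real_eq_iff by blast
qed

text \<open>
  Take \<open>v\<close> to be the difference of \<open>h\<close> and an almost nearest point of \<open>S\<close>.  Subtracting from \<open>v\<close> its
  projection on a vector of \<open>S\<close> cannot bring it closer to \<open>0\<close> than the distance from \<open>h\<close> to \<open>S\<close>, so the
  projection is small.
\<close>

lemma almost_orthogonal_unit_vector: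
  fixes S :: "'h::complex_hilbert set"
  assumes S0: "0 \<in> S" and S: "\<And>x y c. x \<in> S \<Longrightarrow> y \<in> S \<Longrightarrow> x + c *\<^sub>C y \<in> S"
    and h: "h \<notin> closure S" and e: "e > 0"
  shows "\<exists>g. norm g = 1 \<and> (\<forall>s\<in>S. cmod (cinner s g) \<le> e * norm s)"
proof -
  define d where "d = infdist h S"
  have d: "d > 0"
    using h in_closure_iff_infdist_zero[of S h] infdist_nonneg[of h S] S0
    unfolding d_def by (metis empty_iff less_eq_real_def)
  have "d\<^sup>2 < d\<^sup>2 * (1 + e\<^sup>2)" using d e by simp
  then have "d < d * sqrt (1 + e\<^sup>2)" using d e by simp
  then obtain r where r: "r \<in> S" "dist h r < d * sqrt (1 + e\<^sup>2)"
    unfolding d_def using S0 cINF_less_iff[of S "dist h"] infdist_notempty[of S h]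
    by (metis bdd_below_image_dist empty_iff)
  define v where "v = h - r"
  have vd: "d \<le> norm (v - c *\<^sub>C s)" if "s \<in> S" for s c
    using infdist_le[OF S[OF r(1) that, of c], of h] by (simp add: d_def v_def dist_norm algebra_simps)
  have v: "d \<le> norm v" using vd[OF S0, of 1] by simp
  have v2: "(norm v)\<^sup>2 \<le> d\<^sup>2 * (1 + e\<^sup>2)"
  proof -
    have "(norm v)\<^sup>2 \<le> (d * sqrt (1 + e\<^sup>2))\<^sup>2"
      using r(2) by (intro power_mono) (auto simp: v_def dist_norm)
    then show ?thesis by (simp add: power_mult_distrib)
  qed
  have main: "cmod (cinner s v) \<le> e * norm s * norm v" if s: "s \<in> S" for s
  proof (cases "s = 0")
    case False
    have "d\<^sup>2 \<le> (norm v)\<^sup>2 - (cmod (cinner v s))\<^sup>2 / (norm s)\<^sup>2"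
      using power_mono[OF vd[OF s], of 2] d norm_minus_projection[OF False, of v] by (metis less_imp_le)
    then have "(cmod (cinner v s))\<^sup>2 / (norm s)\<^sup>2 \<le> d\<^sup>2 * e\<^sup>2"
      using v2 by (simp add: algebra_simps)
    also have "\<dots> \<le> (norm v)\<^sup>2 * e\<^sup>2" using v d by (intro mult_right_mono power_mono) auto
    finally have "(cmod (cinner v s))\<^sup>2 \<le> (e * norm s * norm v)\<^sup>2"
      using False by (simp add: power_mult_distrib field_simps)
    then have "cmod (cinner v s) \<le> e * norm s * norm v"
      using e by (intro power2_le_imp_le[of "cmod (cinner v s)"]) auto
    then show ?thesis by (metis cinner_commute complex_mod_cnj)
  qed simp
  have vp: "norm v > 0" using v d by linarith
  show ?thesis
  proof (intro exI conjI ballI)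
    show "norm (v /\<^sub>R norm v) = 1" using vp by simp
    show "cmod (cinner s (v /\<^sub>R norm v)) \<le> e * norm s" if "s \<in> S" for s
      using main[OF that] vp by (simp add: cinner_scaleR_right norm_mult norm_divide norm_inverse field_simps)
  qed
qed

section \<open>The spectrum and almost eigenvectors\<close>

definition shifted :: "('h::complex_hilbert \<Rightarrow>\<^sub>L 'h) \<Rightarrow> complex \<Rightarrow> ('h \<Rightarrow>\<^sub>L 'h)"
  where "shifted A z = A - Blinfun (\<lambda>f. z *\<^sub>C f)"

lemma shifted_apply: "shifted A z f = A f - z *\<^sub>C f"
  by (simp add: shifted_def blinfun.diff_left bounded_linear_Blinfun_apply bounded_linear_scaleC)

lemma shifted_scaleC: "A \<in> bounded_operators \<Longrightarrow> shifted A z (c *\<^sub>C f) = c *\<^sub>C shifted A z f"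
  by (simp add: shifted_apply bounded_operators_scaleC scaleC_diff_right scaleC_scaleC mult.commute)

text \<open>
  For a complex linear \<open>A\<close>, the second alternative is the weak form of the statement that the adjoint of
  \<open>A\<close> sends \<open>g\<close> to within \<open>e\<close> of \<open>cnj z *\<^sub>C g\<close>.
\<close>

definition almost_eigenvector :: "('h::complex_hilbert \<Rightarrow>\<^sub>L 'h) \<Rightarrow> complex \<Rightarrow> real \<Rightarrow> 'h \<Rightarrow> bool"
  where "almost_eigenvector A z e g \<longleftrightarrow> norm g = 1 \<and>
    (norm (shifted A z g) \<le> e \<or> (\<forall>f. cmod (cinner (shifted A z f) g) \<le> e * norm f))"

lemma not_spectrum_imp_no_almost_eigenvector:
  fixes A :: "'h::complex_hilbert \<Rightarrow>\<^sub>L 'h"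
  assumes "z \<notin> spectrum A"
  shows "\<exists>e>0. \<forall>g. \<not> almost_eigenvector A z e g"
proof -
  obtain B :: "'h \<Rightarrow>\<^sub>L 'h" where B: "\<And>f. B (shifted A z f) = f" "\<And>f. shifted A z (B f) = f"
    using assms unfolding spectrum_def shifted_apply by blast
  define e where "e = 1 / (norm B + 1)"
  have e: "e > 0" "norm B * e < 1"
    by (auto simp: e_def field_simps add_pos_nonneg add_nonneg_pos)
  have "\<not> almost_eigenvector A z e g" for g
  proof
    assume g: "almost_eigenvector A z e g"
    then have n: "norm g = 1" by (simp add: almost_eigenvector_def)
    from g consider "norm (shifted A z g) \<le> e"
      | "cmod (cinner (shifted A z (B g)) g) \<le> e * norm (B g)"
      unfolding almost_eigenvector_def by blast
    then show False
    proof cases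
      case 1
      have "norm g \<le> norm B * norm (shifted A z g)" using norm_blinfun[of B] B(1) by metis
      also have "\<dots> \<le> norm B * e" using 1 by (intro mult_left_mono) auto
      finally show False using e n by simp
    next
      case 2
      have "norm (B g) \<le> norm B" using norm_blinfun[of B g] n by simp
      then have "e * norm (B g) \<le> norm B * e" using e(1) by (simp add: mult.commute)
      with 2 e show False by (simp add: B(2) cinner_self n)
    qed
  qed
  with e show ?thesis by blast
qed

text \<open>
  The failure of the first alternative bounds \<open>A - z\<close> from below, so it is injective with complete
  range; the failure of the second makes the range dense, by \<open>almost_orthogonal_unit_vector\<close>.
\<close>

lemma no_almost_eigenvector_imp_not_spectrum:
  assumes A: "A \<in> bounded_operators" and e: "e > 0" and none: "\<And>g. \<not> almost_eigenvector A z e g"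
  shows "z \<notin> spectrum A"
proof -
  define T where "T = blinfun_apply (shifted A z)"
  have T: "bounded_linear T" unfolding T_def by (rule blinfun.bounded_linear_right)
  have T_scaleC: "T (c *\<^sub>C f) = c *\<^sub>C T f" for c f
    unfolding T_def using A by (rule shifted_scaleC)
  have below: "e * norm f \<le> norm (T f)" for f
  proof (cases "f = 0")
    case False
    have "norm (T (f /\<^sub>R norm f)) > e"
      using none[of "f /\<^sub>R norm f"] False by (auto simp: almost_eigenvector_def T_def)
    then show ?thesis
      using False by (simp add: linear_scale[OF bounded_linear.linear[OF T]] field_simps)
  qed simp
  have "closure (range T) = UNIV"
  proof (rule ccontr)
    assume "closure (range T) \<noteq> UNIV"
    then obtain h where "h \<notin> closure (range T)" by blast
    moreover have "x + c *\<^sub>C y \<in> range T" if "x \<in> range T" "y \<in> range T" for x y c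
      using that by (auto simp: T_scaleC[symmetric] linear_add[OF bounded_linear.linear[OF T], symmetric])
    \<comment> \<open>The divisor turns a bound by a multiple of \<open>norm (T f)\<close> into one by \<open>e * norm f\<close>.\<close>
    ultimately obtain g where g: "norm g = 1" "\<And>f. cmod (cinner (T f) g) \<le> e / (norm (shifted A z) + 1) * norm (T f)"
      using almost_orthogonal_unit_vector[of "range T" h "e / (norm (shifted A z) + 1)"] e
        linear_0[OF bounded_linear.linear[OF T]]
      by (metis add_nonneg_pos divide_pos_pos norm_ge_zero rangeI zero_less_one)
    have "cmod (cinner (T f) g) \<le> e * norm f" for f
    proof -
      have "norm (T f) \<le> (norm (shifted A z) + 1) * norm f"
        unfolding T_def using norm_blinfun[of "shifted A z" f] by (simp add: distrib_right add_increasing2)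
      then have "e / (norm (shifted A z) + 1) * norm (T f)
          \<le> e / (norm (shifted A z) + 1) * ((norm (shifted A z) + 1) * norm f)"
        using e by (intro mult_left_mono) (auto intro!: divide_nonneg_pos add_nonneg_pos)
      also have "\<dots> = e * norm f"
        using norm_ge_zero[of "shifted A z"] by (simp add: add_nonneg_eq_0_iff)
      finally show ?thesis using g(2)[of f] by linarith
    qed
    then show False using none[of g] g(1) by (auto simp: almost_eigenvector_def T_def)
  qed
  moreover have "complete (range T)"
    using complete_isometric_image[OF e subspace_UNIV T] below complete_UNIV by auto
  ultimately have surj: "range T = UNIV"
    using complete_imp_closed closure_closed by metis
  have inj: "inj T"
  proof (rule injI)
    fix x y assume "T x = T y"
    then have "T (x - y) = 0" by (simp add: linear_diff[OF bounded_linear.linear[OF T]])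
    with below[of "x - y"] e show "x = y" by (simp add: mult_le_0_iff)
  qed
  define B where "B = inv_into UNIV T"
  have TB: "T (B f) = f" and BT: "B (T f) = f" for f
    using surj inj by (auto simp: B_def surj_f_inv_f)
  have B_scaleC: "B (c *\<^sub>C f) = c *\<^sub>C B f" for c f
    by (metis TB BT T_scaleC)
  have "bounded_linear B"
  proof (rule bounded_linear_intro[where K="1/e"])
    show "B (f + g) = B f + B g" for f g
      by (metis TB BT linear_add[OF bounded_linear.linear[OF T]])
    show "B (r *\<^sub>R f) = r *\<^sub>R B f" for r f
      using B_scaleC[of "of_real r" f] by (simp add: scaleC_of_real)
    show "norm (B f) \<le> norm f * (1 / e)" for f
      using below[of "B f"] e by (simp add: TB field_simps)
  qed
  then have "Blinfun B \<in> bounded_operators \<and>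
      (\<forall>f. Blinfun B (A f - z *\<^sub>C f) = f \<and> A (Blinfun B f) - z *\<^sub>C Blinfun B f = f)"
    using B_scaleC TB BT
    by (simp add: bounded_operators_def bounded_linear_Blinfun_apply T_def shifted_apply)
  then show ?thesis unfolding spectrum_def by blast
qed

theorem spectrum_iff_almost_eigenvectors:
  assumes "A \<in> bounded_operators"
  shows "z \<in> spectrum A \<longleftrightarrow> (\<forall>e>0. \<exists>g. almost_eigenvector A z e g)"
  using not_spectrum_imp_no_almost_eigenvector no_almost_eigenvector_imp_not_spectrum[OF assms]
  by metis

lemma almost_eigenvector_mono:
  assumes "almost_eigenvector A z e g" "e \<le> e'"
  shows "almost_eigenvector A z e' g"
  using assms unfolding almost_eigenvector_def
  by (meson mult_right_mono norm_ge_zero order_trans)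

lemma almost_eigenvector_perturb:
  assumes "almost_eigenvector A z e g"
  shows "almost_eigenvector A w (e + cmod (z - w)) g"
proof -
  have g: "norm g = 1" using assms by (simp add: almost_eigenvector_def)
  have s: "shifted A w f = shifted A z f + (z - w) *\<^sub>C f" for f
    by (simp add: shifted_apply scaleC_diff_left)
  have "norm (shifted A w g) \<le> e + cmod (z - w)" if "norm (shifted A z g) \<le> e"
    using norm_triangle_ineq[of "shifted A z g" "(z - w) *\<^sub>C g"] that g unfolding s
    by (simp add: norm_scaleC)
  moreover have "cmod (cinner (shifted A w f) g) \<le> (e + cmod (z - w)) * norm f"
    if "cmod (cinner (shifted A z f) g) \<le> e * norm f" for f
  proof -
    have "cmod (cinner ((z - w) *\<^sub>C f) g) \<le> cmod (z - w) * norm f"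
      using cmod_cinner_le[of "(z - w) *\<^sub>C f" g] g by (simp add: norm_scaleC)
    then show ?thesis
      using that norm_triangle_ineq[of "cinner (shifted A z f) g" "cinner ((z - w) *\<^sub>C f) g"]
      unfolding s cinner_add_left distrib_right by linarith
  qed
  ultimately show ?thesis using assms unfolding almost_eigenvector_def by blast
qed

text \<open>
  An almost eigenvector at \<open>z\<close> is one, with a slightly worse constant, at all points near \<open>z\<close>.
\<close>

lemma closed_spectrum:
  assumes A: "A \<in> bounded_operators"
  shows "closed (spectrum A)"
proof -
  have "w \<in> spectrum A" if w: "w \<in> closure (spectrum A)" for w
    unfolding spectrum_iff_almost_eigenvectors[OF A]
  proof (intro allI impI)
    fix e :: real assume e: "e > 0"
    then obtain z where z: "z \<in> spectrum A" "dist z w < e / 2"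
      using w by (meson closure_approachable half_gt_zero)
    then obtain g where "almost_eigenvector A z (e/2) g"
      using spectrum_iff_almost_eigenvectors[OF A] e by (meson half_gt_zero)
    from almost_eigenvector_perturb[OF this, of w]
    have "almost_eigenvector A w e g"
      by (rule almost_eigenvector_mono) (use z(2) in \<open>simp add: dist_norm\<close>)
    then show "\<exists>g. almost_eigenvector A w e g" ..
  qed
  then show ?thesis by (meson closure_subset_eq subsetI)
qed

lemma spectrum_subset_numerical_range:
  assumes A: "A \<in> bounded_operators"
  shows "spectrum A \<subseteq> closed_numerical_range A"
proof
  fix z assume z: "z \<in> spectrum A"
  show "z \<in> closed_numerical_range A"
    unfolding closed_numerical_range_def closure_approachable
  proof (intro allI impI)
    fix e :: real assume e: "e > 0"
    then obtain g where g: "almost_eigenvector A z (e/2) g"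
      using z spectrum_iff_almost_eigenvectors[OF A] by (meson half_gt_zero)
    then have n: "norm g = 1" by (simp add: almost_eigenvector_def)
    have "cmod (cinner (shifted A z g) g) \<le> e / 2"
      using g cmod_cinner_le[of "shifted A z g" g] n
      unfolding almost_eigenvector_def by (metis mult.right_neutral order_trans)
    moreover have "cinner (shifted A z g) g = cinner (A g) g - z"
      using n by (simp add: shifted_apply cinner_diff_left cinner_scaleC_left cinner_self)
    ultimately have "dist (cinner (A g) g) z < e" using e by (simp add: dist_norm)
    then show "\<exists>y\<in>{cinner (A f) f |f. norm f = 1}. dist y z < e" using n by blast
  qed
qed

lemma norm_le_of_closed_numerical_range:
  assumes "z \<in> closed_numerical_range A"
  shows "cmod z \<le> norm A"
proof -
  have "{cinner (A f) f |f. norm f = 1} \<subseteq> cball 0 (norm A)"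
  proof clarsimp
    fix f :: 'a assume "norm f = 1"
    then show "cmod (cinner (A f) f) \<le> norm A"
      using cmod_cinner_le[of "A f" f] norm_blinfun[of A f] by simp
  qed
  from closure_minimal[OF this closed_cball] assms show ?thesis
    by (auto simp: closed_numerical_range_def)
qed

section \<open>Square summable functions: slices, restrictions and potentials\<close>

lemma norm_ell2_pointwise_le:
  assumes "\<And>x. norm (ell2_apply f x) \<le> c * norm (ell2_apply g x)" "0 \<le> c"
  shows "norm f \<le> c * norm g"
proof (rule norm_ell2_leI)
  fix F :: "'a set" assume F: "finite F"
  have "(\<Sum>x\<in>F. (norm (ell2_apply f x))\<^sup>2) \<le> (\<Sum>x\<in>F. c\<^sup>2 * (norm (ell2_apply g x))\<^sup>2)"
    by (rule sum_mono) (auto simp flip: power_mult_distrib intro!: power_mono assms)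
  also have "\<dots> \<le> (c * norm g)\<^sup>2"
    unfolding sum_distrib_left[symmetric] power_mult_distrib
    by (intro mult_left_mono ell2_finite_sum_le F) simp
  finally show "(\<Sum>x\<in>F. (norm (ell2_apply f x))\<^sup>2) \<le> (c * norm g)\<^sup>2" .
qed (use assms in simp)

text \<open>
  The vectors supported at one point span a dense subspace.
\<close>

lemma bounded_linear_eq_on_singles:
  assumes "bounded_linear S" "bounded_linear T"
    and eq: "\<And>y k. S (single_ell2 y k) = T (single_ell2 y k)"
  shows "S f = T f"
proof -
  have "((\<lambda>y. T (single_ell2 y (ell2_apply f y))) has_sum S f) UNIV"
    using has_sum_bounded_linear[OF assms(1) has_sum_singles[of f]] by (simp add: eq)
  moreover have "((\<lambda>y. T (single_ell2 y (ell2_apply f y))) has_sum T f) UNIV"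
    by (rule has_sum_bounded_linear[OF assms(2) has_sum_singles])
  ultimately show ?thesis by (rule has_sum_unique)
qed

lemma single_eq_tensor: "single_ell2 y k = tensor_ell2 (single_ell2 y 1) k"
  by (simp add: tensor_single scaleC_one)

lemma
  assumes "H0 \<in> bounded_operators"
  shows tensor_identity_bounded: "tensor_identity H0 \<in> bounded_operators"
    and tensor_identity_tensor: "tensor_identity H0 (tensor_ell2 g k) = tensor_ell2 (H0 g) k"
  using theI'[OF tensor_identity_ex1[OF assms]] unfolding tensor_identity_def by blast+

text \<open>
  The adjoint of the map \<open>g \<mapsto> g \<otimes> u\<close>: it takes the inner product with \<open>u\<close> at each point.
\<close>

lift_definition slice :: "'k::complex_hilbert \<Rightarrow> ('x, 'k) ell2 \<Rightarrow> ('x, complex) ell2"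
  is "\<lambda>u f x. cinner (f x) u"
proof -
  fix u :: 'k and f :: "'x \<Rightarrow> 'k"
  assume "square_summable f"
  then show "square_summable (\<lambda>x. cinner (f x) u)"
    by (rule square_summable_bounded[where C="norm u"])
      (simp add: cmod_cinner_le mult.commute[of "norm u"])
qed

lemma norm_slice_le: "norm (slice u f) \<le> norm u * norm f"
  by (rule norm_ell2_pointwise_le) (auto simp: slice.rep_eq cmod_cinner_le mult.commute[of "norm u"])

lemma bounded_linear_slice: "bounded_linear (slice u)"
proof (rule bounded_linear_intro[where K="norm u"])
  show "norm (slice u f) \<le> norm f * norm u" for f
    using norm_slice_le[of u f] by (simp add: mult.commute)
qed (rule ell2_eqI, simp add: slice.rep_eq plus_ell2.rep_eq scaleR_ell2.rep_eq cinner_add_left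
    cinner_scaleR_left scaleR_conv_of_real)+

lemma slice_scaleC: "slice u (c *\<^sub>C f) = c *\<^sub>C slice u f"
  by (rule ell2_eqI) (simp add: slice.rep_eq scaleC_ell2.rep_eq cinner_scaleC_left scaleC_complex_def)

lemma slice_tensor: "slice u (tensor_ell2 g k) = cinner k u *\<^sub>C g"
  by (rule ell2_eqI)
    (simp add: slice.rep_eq tensor_ell2.rep_eq scaleC_ell2.rep_eq cinner_scaleC_left scaleC_complex_def)

lemma cinner_tensor_right: "cinner f (tensor_ell2 g u) = cinner (slice u f) g"
  unfolding cinner_ell2.rep_eq
  by (simp add: slice.rep_eq tensor_ell2.rep_eq cinner_scaleC_right cinner_complex_def mult.commute)

text \<open>
  Slicing intertwines \<open>H0 \<otimes> I\<close> with \<open>H0\<close>; this is how bounds on \<open>H0\<close> pass to \<open>H0 \<otimes> I\<close>.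
\<close>

lemma slice_tensor_identity:
  assumes "H0 \<in> bounded_operators"
  shows "slice u (tensor_identity H0 f) = H0 (slice u f)"
proof (rule bounded_linear_eq_on_singles[where S="\<lambda>f. slice u (tensor_identity H0 f)"
      and T="\<lambda>f. H0 (slice u f)"])
  show "slice u (tensor_identity H0 (single_ell2 y k)) = H0 (slice u (single_ell2 y k))" for y k
    unfolding single_eq_tensor[of y k] tensor_identity_tensor[OF assms] slice_tensor
    by (simp add: bounded_operators_scaleC[OF assms])
qed (auto intro!: bounded_linear_compose[OF bounded_linear_slice]
    bounded_linear_compose[OF _ bounded_linear_slice] blinfun.bounded_linear_right)

lemma shifted_tensor_identity_tensor:
  assumes "H0 \<in> bounded_operators"
  shows "shifted (tensor_identity H0) z (tensor_ell2 g k) = tensor_ell2 (shifted H0 z g) k"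
  by (rule ell2_eqI)
    (simp add: shifted_apply tensor_identity_tensor[OF assms] minus_ell2.rep_eq tensor_ell2.rep_eq
      scaleC_ell2.rep_eq scaleC_diff_left scaleC_complex_def scaleC_scaleC)

lemma potential_bounded_operator:
  fixes V :: "'x \<Rightarrow> 'k::complex_hilbert \<Rightarrow>\<^sub>L 'k"
  assumes "bounded (range V)" "range V \<subseteq> bounded_operators"
  shows "potential_operator V \<in> bounded_operators"
  unfolding bounded_operators_def
proof (intro CollectI allI)
  fix c :: complex and f :: "('x, 'k) ell2"
  have "V x (c *\<^sub>C k) = c *\<^sub>C V x k" for x k
    using assms(2) by (intro bounded_operators_scaleC) blast
  then show "potential_operator V (c *\<^sub>C f) = c *\<^sub>C potential_operator V f"
    by (intro ell2_eqI) (simp add: potential_operator_apply[OF assms(1)] scaleC_ell2.rep_eq)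
qed

lemma bounded_operators_add:
  "A \<in> bounded_operators \<Longrightarrow> B \<in> bounded_operators \<Longrightarrow> A + B \<in> bounded_operators"
  by (simp add: bounded_operators_def blinfun.add_left scaleC_add_right)

lift_definition restriction :: "'x set \<Rightarrow> ('x, 'k::complex_hilbert) ell2 \<Rightarrow> ('x, 'k) ell2"
  is "\<lambda>F f x. if x \<in> F then f x else 0"
  by (rule square_summable_bounded[where C=1]) auto

lemma restriction_eq_sum:
  "finite F \<Longrightarrow> restriction F f = (\<Sum>y\<in>F. single_ell2 y (ell2_apply f y))"
  by (rule ell2_eqI) (simp add: restriction.rep_eq ell2_apply_sum single_ell2.rep_eq)

lemma restriction_tendsto: "((\<lambda>F. restriction F f) \<longlongrightarrow> f) (finite_subsets_at_top UNIV)"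
proof (rule Lim_transform_eventually)
  show "((\<lambda>F. \<Sum>y\<in>F. single_ell2 y (ell2_apply f y)) \<longlongrightarrow> f) (finite_subsets_at_top UNIV)"
    using has_sum_singles[of f] by (simp add: has_sum_def)
qed (intro eventually_finite_subsets_at_top_weakI, simp add: restriction_eq_sum)

lemma finite_restriction_approx:
  assumes "e > 0"
  shows "\<exists>F. finite F \<and> norm (f - restriction F f) < e"
proof -
  have "\<forall>\<^sub>F F in finite_subsets_at_top UNIV. dist (restriction F f) f < e"
    by (rule tendstoD[OF restriction_tendsto assms])
  then show ?thesis
    unfolding eventually_finite_subsets_at_top dist_norm by (metis norm_minus_commute subset_UNIV order_refl)
qed

text \<open>
  Restriction to a set is an orthogonal projection.
\<close>

lemma cinner_restriction: "cinner f (restriction F g) = cinner (restriction F f) g"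
  unfolding cinner_ell2.rep_eq
  by (rule infsum_cong) (simp add: restriction.rep_eq cinner_zero_right)

text \<open>
  A potential that is small on \<open>F\<close> and bounded elsewhere nearly annihilates, from either side, a vector
  concentrated on \<open>F\<close>.  The second bound serves the almost eigenvectors of the adjoint.
\<close>

lemma
  fixes D :: "'x \<Rightarrow> 'k::complex_hilbert \<Rightarrow>\<^sub>L 'k"
  assumes C: "\<And>x. norm (D x) \<le> C" and F: "\<And>x. x \<in> F \<Longrightarrow> norm (D x) \<le> d" and d: "0 \<le> d"
  shows norm_potential_local_le:
      "norm (potential_operator D g) \<le> d * norm g + C * norm (g - restriction F g)"
    and cinner_potential_local_le:
      "cmod (cinner (potential_operator D f) g) \<le> (d * norm g + C * norm (g - restriction F g)) * norm f"
proof -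
  have C0: "0 \<le> C" using C norm_ge_zero order_trans by blast
  have bd: "bounded (range D)" using C by (auto simp: bounded_iff)
  note ap = potential_operator_apply[OF bd]
  have norm_le: "norm (potential_operator D f) \<le> C * norm f" for f
    by (rule norm_ell2_pointwise_le[OF _ C0])
      (metis ap C mult_right_mono norm_blinfun norm_ge_zero order_trans)
  have D: "norm (D x k) \<le> d * norm k" if "x \<in> F" for x k
    using F[OF that] by (metis mult_right_mono norm_blinfun norm_ge_zero order_trans)
  have inside: "norm (potential_operator D (restriction F g)) \<le> d * norm g" for g
    by (rule norm_ell2_pointwise_le) (auto simp: ap restriction.rep_eq D d)
  have inside': "norm (restriction F (potential_operator D g)) \<le> d * norm g" for g
    by (rule norm_ell2_pointwise_le) (auto simp: ap restriction.rep_eq D d)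
  have "potential_operator D g
      = potential_operator D (restriction F g) + potential_operator D (g - restriction F g)"
    by (simp add: blinfun.diff_right)
  then show "norm (potential_operator D g) \<le> d * norm g + C * norm (g - restriction F g)"
    using inside[of g] norm_le[of "g - restriction F g"] norm_triangle_mono by metis
  have "cinner (potential_operator D f) g
      = cinner (restriction F (potential_operator D f)) g + cinner (potential_operator D f) (g - restriction F g)"
    by (simp add: cinner_diff_right cinner_restriction)
  also have "cmod \<dots> \<le> (d * norm f) * norm g + (C * norm f) * norm (g - restriction F g)"
    by (intro norm_triangle_mono order_trans[OF cmod_cinner_le] mult_right_mono inside' norm_le) auto
  finally show "cmod (cinner (potential_operator D f) g)
      \<le> (d * norm g + C * norm (g - restriction F g)) * norm f"
    by (simp add: algebra_simps)
qed

section \<open>Spectra of sums of commuting operators\<close>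

lemma bounded_constant_range: "bounded (range (\<lambda>_. A))"
  by (simp add: image_constant_conv)

lemma tensor_identity_constant_potential_commute:
  fixes A :: "'k::complex_hilbert \<Rightarrow>\<^sub>L 'k"
  assumes H0: "H0 \<in> bounded_operators" and A: "A \<in> bounded_operators"
  shows "tensor_identity H0 (potential_operator (\<lambda>_. A) f)
    = potential_operator (\<lambda>_. A) (tensor_identity H0 f)"
proof (rule bounded_linear_eq_on_singles[where
      S="\<lambda>f. tensor_identity H0 (potential_operator (\<lambda>_. A) f)"
      and T="\<lambda>f. potential_operator (\<lambda>_. A) (tensor_identity H0 f)"])
  have P: "potential_operator (\<lambda>_. A) (tensor_ell2 g k) = tensor_ell2 g (A k)" for g :: "('a, complex) ell2" and k
    by (rule ell2_eqI) (simp add: potential_operator_apply[OF bounded_constant_range] tensor_ell2.rep_eq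
        bounded_operators_scaleC[OF A])
  show "tensor_identity H0 (potential_operator (\<lambda>_. A) (single_ell2 y k))
      = potential_operator (\<lambda>_. A) (tensor_identity H0 (single_ell2 y k))" for y k
    unfolding single_eq_tensor[of y k] by (simp add: P tensor_identity_tensor[OF H0])
qed (auto intro!: bounded_linear_compose[OF blinfun.bounded_linear_right] blinfun.bounded_linear_right)

text \<open>
  An inverse \<open>R\<close> of \<open>a + b\<close> commutes with \<open>a\<close> and with \<open>b\<close>, since these commute with each other.
  Hence in \<open>\<langle>v, v\<rangle> = \<langle>a R v, v\<rangle> + \<langle>b R v, v\<rangle>\<close> each factor \<open>a\<close>, \<open>b\<close> may act on the side of \<open>R\<close> where
  \<open>v\<close> is an almost eigenvector: on \<open>v\<close> itself if the almost eigenvector is of the first kind, and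
  against \<open>v\<close> in the second slot of the inner product if it is of the second kind.  This treats uniformly the
  case that \<open>H0 - z\<close> fails to be bounded below while \<open>A - w\<close> fails to have dense range, in which
  \<open>g \<otimes> k\<close> may be an almost eigenvector of neither kind.
\<close>

lemma spectrum_sum_constant_potential:
  fixes A :: "'k::complex_hilbert \<Rightarrow>\<^sub>L 'k" and H0 :: "('x, complex) ell2 \<Rightarrow>\<^sub>L ('x, complex) ell2"
  assumes H0: "H0 \<in> bounded_operators" and A: "A \<in> bounded_operators"
    and z: "z \<in> spectrum H0" and w: "w \<in> spectrum A"
  shows "z + w \<in> spectrum (tensor_identity H0 + potential_operator (\<lambda>_. A))"
proof (rule ccontr)
  let ?L = "tensor_identity H0 + potential_operator (\<lambda>_. A) :: ('x, 'k) ell2 \<Rightarrow>\<^sub>L ('x, 'k) ell2"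
  assume "z + w \<notin> spectrum ?L"
  then obtain R :: "('x, 'k) ell2 \<Rightarrow>\<^sub>L ('x, 'k) ell2" where R: "\<And>f. R (shifted ?L (z + w) f) = f" "\<And>f. shifted ?L (z + w) (R f) = f"
    unfolding spectrum_def shifted_apply by blast
  define a where "a = shifted (tensor_identity H0 :: ('x, 'k) ell2 \<Rightarrow>\<^sub>L ('x, 'k) ell2) z"
  define b where "b = shifted (potential_operator (\<lambda>_. A) :: ('x, 'k) ell2 \<Rightarrow>\<^sub>L ('x, 'k) ell2) w"
  note Pb = potential_bounded_operator[OF bounded_constant_range[of A], simplified, OF A]
  note Tb = tensor_identity_bounded[OF H0]
  have L: "shifted ?L (z + w) f = a f + b f" for f
    by (simp add: a_def b_def shifted_apply blinfun.add_left scaleC_add_left)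
  have ab: "a (b f) = b (a f)" for f
    unfolding a_def b_def
    by (simp add: shifted_apply blinfun.diff_right tensor_identity_constant_potential_commute[OF H0 A]
        bounded_operators_scaleC[OF Tb] bounded_operators_scaleC[OF Pb]
        scaleC_diff_right scaleC_scaleC mult.commute)
  have aR: "a (R f) = R (a f)" for f
    using R(1)[of "a (R f)"] R(2)[of f] unfolding L
    by (metis ab blinfun.add_right)
  have bR: "b (R f) = R (b f)" for f
    using R(1)[of "b (R f)"] R(2)[of f] unfolding L
    by (metis ab blinfun.add_right)
  \<comment> \<open>With this \<open>e\<close> each of the two terms has modulus at most \<open>1 / 4\<close>.\<close>
  define e where "e = 1 / (4 * (norm R + 1))"
  have e: "e > 0" "norm R * e \<le> 1 / 4"
    by (auto simp: e_def field_simps add_pos_nonneg add_nonneg_pos)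
  obtain g where g: "almost_eigenvector H0 z e g"
    using z spectrum_iff_almost_eigenvectors[OF H0] e by blast
  obtain k where k: "almost_eigenvector A w e k"
    using w spectrum_iff_almost_eigenvectors[OF A] e by blast
  have n: "norm g = 1" "norm k = 1" using g k by (auto simp: almost_eigenvector_def)
  define v where "v = tensor_ell2 g k"
  have v: "norm v = 1" by (simp add: v_def norm_tensor_ell2 n)
  have Rv: "norm (R v) \<le> norm R" using norm_blinfun[of R v] v by simp
  have via_R: "cmod (cinner (R f) v) \<le> 1 / 4" if "norm f \<le> e" for f
  proof -
    have "cmod (cinner (R f) v) \<le> norm (R f)" using cmod_cinner_le[of "R f" v] v by simp
    also have "\<dots> \<le> norm R * norm f" by (rule norm_blinfun)
    also have "\<dots> \<le> norm R * e" using that by (intro mult_left_mono) auto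
    finally show ?thesis using e by simp
  qed
  have via_slice: "x \<le> 1 / 4" if "x \<le> e * norm (R v)" for x
  proof -
    have "e * norm (R v) \<le> e * norm R" using Rv e by (intro mult_left_mono) auto
    then show ?thesis using that e(2) by (simp add: mult.commute)
  qed
  have 1: "cmod (cinner (a (R v)) v) \<le> 1 / 4"
  proof (cases "norm (shifted H0 z g) \<le> e")
    case True
    have "norm (a v) \<le> e"
      using True by (simp add: a_def v_def shifted_tensor_identity_tensor[OF H0] norm_tensor_ell2 n)
    then show ?thesis unfolding aR by (rule via_R)
  next
    case False
    then have "cmod (cinner (shifted H0 z (slice k (R v))) g) \<le> e * norm (slice k (R v))"
      using g by (simp add: almost_eigenvector_def)
    also have "\<dots> \<le> e * norm (R v)"
      using norm_slice_le[of k "R v"] e n by (intro mult_left_mono) auto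
    also have "shifted H0 z (slice k (R v)) = slice k (a (R v))"
      by (simp add: a_def shifted_apply linear_diff[OF bounded_linear.linear[OF bounded_linear_slice]]
          slice_scaleC slice_tensor_identity[OF H0])
    finally show ?thesis
      by (intro via_slice) (simp add: v_def cinner_tensor_right)
  qed
  have 2: "cmod (cinner (b (R v)) v) \<le> 1 / 4"
  proof (cases "norm (shifted A w k) \<le> e")
    case True
    have "b v = tensor_ell2 g (shifted A w k)"
      by (rule ell2_eqI) (simp add: b_def v_def shifted_apply potential_operator_apply[OF bounded_constant_range]
          tensor_ell2.rep_eq minus_ell2.rep_eq scaleC_ell2.rep_eq scaleC_diff_right scaleC_scaleC
          bounded_operators_scaleC[OF A] mult.commute)
    then have "norm (b v) \<le> e" using True by (simp add: norm_tensor_ell2 n)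
    then show ?thesis unfolding bR by (rule via_R)
  next
    case False
    have "norm (slice k (b (R v))) \<le> e * norm (R v)"
    proof (rule norm_ell2_pointwise_le)
      fix x
      have "ell2_apply (slice k (b (R v))) x = cinner (shifted A w (ell2_apply (R v) x)) k"
        by (simp add: b_def slice.rep_eq shifted_apply potential_operator_apply[OF bounded_constant_range]
            minus_ell2.rep_eq scaleC_ell2.rep_eq)
      then show "norm (ell2_apply (slice k (b (R v))) x) \<le> e * norm (ell2_apply (R v) x)"
        using False k by (simp add: almost_eigenvector_def)
    qed (use e in simp)
    then show ?thesis
      using cmod_cinner_le[of "slice k (b (R v))" g] n
      by (intro via_slice) (simp add: v_def cinner_tensor_right)
  qed
  have "1 = cmod (cinner v v)" by (simp add: cinner_self v)
  also have "cinner v v = cinner (a (R v)) v + cinner (b (R v)) v"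
    using R(2)[of v] by (simp add: L cinner_add_left[symmetric])
  also have "cmod \<dots> \<le> 1/4 + 1/4" using 1 2 by (rule norm_triangle_mono)
  finally show False by simp
qed

section \<open>Translated almost eigenvectors\<close>

lemma translation_scaleC:
  assumes "group_action G UNIV \<phi>" "\<gamma> \<in> carrier G"
  shows "translation G \<phi> \<gamma> (c *\<^sub>C f) = c *\<^sub>C translation G \<phi> \<gamma> f"
  by (rule ell2_eqI) (simp add: translation_apply[OF assms] scaleC_ell2.rep_eq)

lemma translation_cancel:
  assumes "group_action G UNIV \<phi>" "\<gamma> \<in> carrier G"
  shows "translation G \<phi> \<gamma> (translation G \<phi> (inv\<^bsub>G\<^esub> \<gamma>) f) = f"
    and "\<phi> \<gamma> (\<phi> (inv\<^bsub>G\<^esub> \<gamma>) x) = x"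
proof -
  interpret group_action G UNIV \<phi> by fact
  interpret group G using group_hom by (rule group_hom.axioms)
  have i: "inv\<^bsub>G\<^esub> \<gamma> \<in> carrier G" using assms(2) by simp
  have c: "\<phi> \<gamma> (\<phi> (inv\<^bsub>G\<^esub> \<gamma>) x) = x" for x
    using orbit_sym_aux[OF i UNIV_I, of x] assms(2) by simp
  then show "\<phi> \<gamma> (\<phi> (inv\<^bsub>G\<^esub> \<gamma>) x) = x" .
  show "translation G \<phi> \<gamma> (translation G \<phi> (inv\<^bsub>G\<^esub> \<gamma>) f) = f"
    by (rule ell2_eqI) (simp add: translation_apply[OF assms(1)] i assms(2) c)
qed

lemma cinner_translation:
  fixes f g :: "('x, 'k::complex_hilbert) ell2"
  assumes "group_action G UNIV \<phi>" "\<gamma> \<in> carrier G"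
  shows "cinner (translation G \<phi> \<gamma> f) (translation G \<phi> \<gamma> g) = cinner f g"
proof -
  interpret group_action G UNIV \<phi> by fact
  interpret group G using group_hom by (rule group_hom.axioms)
  have "bij (\<phi> (inv\<^bsub>G\<^esub> \<gamma>))"
    using bij_prop0[of "inv\<^bsub>G\<^esub> \<gamma>"] assms(2) by (auto simp: Bij_def)
  from infsum_reindex_bij_betw[OF this, of "\<lambda>x. cinner (ell2_apply f x) (ell2_apply g x)"]
  show ?thesis by (simp add: cinner_ell2.rep_eq translation_apply[OF assms])
qed

lemma norm_translation:
  fixes f :: "('x, 'k::complex_hilbert) ell2"
  assumes "group_action G UNIV \<phi>" "\<gamma> \<in> carrier G"
  shows "norm (translation G \<phi> \<gamma> f) = norm f"
  by (simp add: norm_eq_sqrt_inner inner_eq_Re_cinner cinner_translation[OF assms])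

lemma translation_tensor:
  assumes "group_action G UNIV \<phi>" "\<gamma> \<in> carrier G"
  shows "translation G \<phi> \<gamma> (tensor_ell2 g k) = tensor_ell2 (translation G \<phi> \<gamma> g) k"
  by (rule ell2_eqI) (simp add: translation_apply[OF assms] tensor_ell2.rep_eq)

lemma tensor_identity_translation:
  fixes f :: "('x, 'k::complex_hilbert) ell2"
  assumes "group_action G UNIV \<phi>" "\<gamma> \<in> carrier G" and H0: "H0 \<in> bounded_operators"
    and inv: "H0 o\<^sub>L translation G \<phi> \<gamma> = translation G \<phi> \<gamma> o\<^sub>L H0"
  shows "tensor_identity H0 (translation G \<phi> \<gamma> f) = translation G \<phi> \<gamma> (tensor_identity H0 f)"
proof (rule bounded_linear_eq_on_singles[where
      S="\<lambda>f. tensor_identity H0 (translation G \<phi> \<gamma> f)"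
      and T="\<lambda>f. translation G \<phi> \<gamma> (tensor_identity H0 f)"])
  have c: "H0 (translation G \<phi> \<gamma> g) = translation G \<phi> \<gamma> (H0 g)" for g
    using arg_cong[OF inv, of "\<lambda>T. blinfun_apply T g"] by simp
  show "tensor_identity H0 (translation G \<phi> \<gamma> (single_ell2 y k))
      = translation G \<phi> \<gamma> (tensor_identity H0 (single_ell2 y k))" for y and k :: 'k
    unfolding single_eq_tensor[of y k]
    by (simp add: tensor_identity_tensor[OF H0] translation_tensor[OF assms(1,2)] c)
qed (auto intro!: bounded_linear_compose[OF blinfun.bounded_linear_right] blinfun.bounded_linear_right)

lemma potential_translation:
  fixes f :: "('x, 'k::complex_hilbert) ell2"
  assumes "group_action G UNIV \<phi>" "\<gamma> \<in> carrier G" and V: "bounded (range V)"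
  shows "potential_operator V (translation G \<phi> \<gamma> f)
    = translation G \<phi> \<gamma> (potential_operator (\<lambda>x. V (\<phi> \<gamma> x)) f)"
proof (rule ell2_eqI)
  have "bounded (range (\<lambda>x. V (\<phi> \<gamma> x)))"
    by (rule bounded_subset[OF V]) auto
  then show "ell2_apply (potential_operator V (translation G \<phi> \<gamma> f)) x
    = ell2_apply (translation G \<phi> \<gamma> (potential_operator (\<lambda>x. V (\<phi> \<gamma> x)) f)) x" for x
    by (simp add: potential_operator_apply[OF V] potential_operator_apply
        translation_apply[OF assms(1,2)] translation_cancel(2)[OF assms(1,2)])
qed

text \<open>
  For suitable \<open>\<gamma>\<close> the translate of \<open>H\<close> by \<open>\<gamma>\<close> differs from \<open>L\<close> by a potential \<open>D\<close> that is small on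
  the finite set where most of a given almost eigenvector of \<open>L\<close> lives.  Although the norm of \<open>D\<close>
  may be large, \<open>D\<close> and its adjoint act on that vector as a small perturbation, which is all that being
  an almost eigenvector depends on.
\<close>

lemma spectrum_constant_potential_subset:
  fixes H0 :: "('x, complex) ell2 \<Rightarrow>\<^sub>L ('x, complex) ell2"
    and V :: "'x \<Rightarrow> 'k::complex_hilbert \<Rightarrow>\<^sub>L 'k"
  assumes action: "group_action G UNIV \<phi>" and H0: "H0 \<in> bounded_operators"
    and inv: "\<And>\<gamma>. \<gamma> \<in> carrier G \<Longrightarrow> H0 o\<^sub>L translation G \<phi> \<gamma> = translation G \<phi> \<gamma> o\<^sub>L H0"
    and M: "M \<subseteq> bounded_operators" "bounded M" and V: "pseudo_ergodic G \<phi> M V" and A: "A \<in> M"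
  shows "spectrum (tensor_identity H0 + potential_operator (\<lambda>_. A))
    \<subseteq> spectrum (tensor_identity H0 + potential_operator V)"
proof
  let ?T = "tensor_identity H0 :: ('x, 'k) ell2 \<Rightarrow>\<^sub>L ('x, 'k) ell2"
  let ?L = "?T + potential_operator (\<lambda>_. A)" and ?H = "?T + potential_operator V"
  have VM: "range V \<subseteq> M" using V by (simp add: pseudo_ergodic_def)
  have Vb: "bounded (range V)" using bounded_subset[OF M(2) VM] .
  have Lb: "?L \<in> bounded_operators" and Hb: "?H \<in> bounded_operators"
    using M VM A Vb by (auto intro!: bounded_operators_add tensor_identity_bounded[OF H0]
        potential_bounded_operator bounded_constant_range)
  obtain C where C: "\<And>B. B \<in> M \<Longrightarrow> norm B \<le> C" and C0: "C > 0"
    using M(2) by (auto simp: bounded_pos)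
  fix z assume z: "z \<in> spectrum ?L"
  show "z \<in> spectrum ?H"
    unfolding spectrum_iff_almost_eigenvectors[OF Hb]
  proof (intro allI impI)
    fix e :: real assume e: "e > 0"
    obtain g where g: "almost_eigenvector ?L z (e/3) g"
      using z spectrum_iff_almost_eigenvectors[OF Lb] e
      by (metis divide_pos_pos zero_less_numeral)
    then have n: "norm g = 1" by (simp add: almost_eigenvector_def)
    \<comment> \<open>Off \<open>F\<close> the potential \<open>D\<close> below is only bounded by \<open>2 * C\<close>; what is left of \<open>g\<close> there
      contributes at most \<open>2 * C * (e / (6 * C)) = e / 3\<close>.\<close>
    have "0 < e / (6 * C)" using e C0 by simp
    then obtain F where F: "finite F" "norm (g - restriction F g) < e / (6 * C)"
      using finite_restriction_approx by blast
    have "\<forall>W. W ` F \<subseteq> M \<longrightarrow> (\<exists>\<gamma>\<in>carrier G. \<forall>x\<in>F. norm (W x - V (\<phi> \<gamma> x)) < e / 3)"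
      using V F(1) e unfolding pseudo_ergodic_def
      by (metis divide_pos_pos zero_less_numeral)
    from this[rule_format, of "\<lambda>_. A"]
    obtain \<gamma> where \<gamma>: "\<gamma> \<in> carrier G" "\<And>x. x \<in> F \<Longrightarrow> norm (A - V (\<phi> \<gamma> x)) < e / 3"
      using A by auto
    define U where "U = (translation G \<phi> \<gamma> :: ('x, 'k) ell2 \<Rightarrow>\<^sub>L ('x, 'k) ell2)"
    define D where "D x = V (\<phi> \<gamma> x) - A" for x
    have Db: "norm (D x) \<le> 2 * C" for x
      using C[OF A] C[of "V (\<phi> \<gamma> x)"] VM norm_triangle_ineq4[of "V (\<phi> \<gamma> x)" A]
      by (force simp: D_def)
    have DF: "norm (D x) \<le> e / 3" if "x \<in> F" for x
      using \<gamma>(2)[OF that] by (simp add: D_def norm_minus_commute)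
    have "e / 3 * norm g + 2 * C * norm (g - restriction F g) \<le> e / 3 + 2 * C * (e / (6 * C))"
      using F(2) C0 n by (intro add_mono mult_left_mono) auto
    also have "\<dots> = 2 * e / 3" using C0 by (simp add: field_simps)
    finally have small: "e / 3 * norm g + 2 * C * norm (g - restriction F g) \<le> 2 * e / 3" .
    have bd: "bounded (range (\<lambda>x. V (\<phi> \<gamma> x)))" "bounded (range D)"
      by (rule bounded_subset[OF Vb], auto) (use Db in \<open>auto simp: bounded_iff\<close>)
    have HU: "shifted ?H z (U f) = U (shifted ?L z f + potential_operator D f)" for f
    proof -
      have "potential_operator (\<lambda>x. V (\<phi> \<gamma> x)) f = potential_operator (\<lambda>_. A) f + potential_operator D f"
        by (rule ell2_eqI) (simp add: potential_operator_apply[OF bd(1)] potential_operator_apply[OF bd(2)]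
            potential_operator_apply[OF bounded_constant_range] plus_ell2.rep_eq D_def blinfun.diff_left)
      then show ?thesis
        unfolding U_def
        by (simp add: shifted_apply blinfun.add_left blinfun.add_right blinfun.diff_right
            tensor_identity_translation[OF action \<gamma>(1) H0 inv[OF \<gamma>(1)]]
            potential_translation[OF action \<gamma>(1) Vb] translation_scaleC[OF action \<gamma>(1)])
    qed
    have "almost_eigenvector ?H z e (U g)"
      unfolding almost_eigenvector_def
    proof (intro conjI)
      show "norm (U g) = 1" using n by (simp add: U_def norm_translation[OF action \<gamma>(1)])
      show "norm (shifted ?H z (U g)) \<le> e \<or>
          (\<forall>f. cmod (cinner (shifted ?H z f) (U g)) \<le> e * norm f)"
      proof (cases "norm (shifted ?L z g) \<le> e / 3")
        case True
        have "norm (shifted ?H z (U g)) \<le> norm (shifted ?L z g) + norm (potential_operator D g)"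
          unfolding HU by (simp add: U_def norm_translation[OF action \<gamma>(1)] norm_triangle_ineq)
        also have "\<dots> \<le> e / 3 + 2 * e / 3"
          using True norm_potential_local_le[of D "2*C" F "e/3" g] Db DF e small
          by (intro add_mono) auto
        finally show ?thesis by simp
      next
        case False
        have "cmod (cinner (shifted ?H z f) (U g)) \<le> e * norm f" for f
        proof -
          define h where "h = translation G \<phi> (inv\<^bsub>G\<^esub> \<gamma>) f"
          have f: "f = U h" by (simp add: U_def h_def translation_cancel(1)[OF action \<gamma>(1)])
          have nf: "norm f = norm h" by (simp add: f U_def norm_translation[OF action \<gamma>(1)])
          have "cinner (shifted ?H z f) (U g) = cinner (shifted ?L z h) g + cinner (potential_operator D h) g"
            unfolding f HU by (simp add: U_def cinner_translation[OF action \<gamma>(1)] cinner_add_left)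
          also have "cmod \<dots> \<le> e / 3 * norm h + 2 * e / 3 * norm h"
          proof (rule norm_triangle_mono)
            show "cmod (cinner (shifted ?L z h) g) \<le> e / 3 * norm h"
              using False g by (simp add: almost_eigenvector_def)
            have "cmod (cinner (potential_operator D h) g)
                \<le> (e / 3 * norm g + 2 * C * norm (g - restriction F g)) * norm h"
              using Db DF e by (intro cinner_potential_local_le) auto
            also have "\<dots> \<le> 2 * e / 3 * norm h" using small by (rule mult_right_mono) simp
            finally show "cmod (cinner (potential_operator D h) g) \<le> 2 * e / 3 * norm h" .
          qed
          finally show ?thesis by (simp add: nf)
        qed
        then show ?thesis by blast
      qed
    qed
    then show "\<exists>g. almost_eigenvector ?H z e g" ..
  qed
qed

section \<open>Numerical ranges\<close>

text \<open>
  The Toeplitz-Hausdorff theorem.  The form \<open>Q\<close> is that of \<open>A\<close> normalised by an affine map of the plane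
  so that the wanted value becomes \<open>0\<close> and the values at \<open>f\<close> and \<open>g\<close> become the reals \<open>- t\<close> and \<open>1 - t\<close>.  After
  multiplying \<open>g\<close> by a suitable phase \<open>c\<close>, the form is real along the segment from \<open>f\<close> to \<open>c g\<close>, and
  the intermediate value theorem applies.
\<close>

lemma convex_numerical_range:
  fixes A :: "'h::complex_hilbert \<Rightarrow>\<^sub>L 'h"
  assumes A: "A \<in> bounded_operators"
  shows "convex {cinner (A f) f | f. norm f = 1}"
  unfolding convex_alt
proof clarify
  fix f g :: 'h and t :: real
  assume f: "norm f = 1" and g: "norm g = 1" and t: "0 \<le> t" "t \<le> 1"
  define p where "p = cinner (A f) f"
  define q where "q = cinner (A g) g"
  define m where "m = (1 - t) *\<^sub>R p + t *\<^sub>R q"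
  have "\<exists>h. norm h = 1 \<and> cinner (A h) h = m"
  proof (cases "p = q")
    case True
    have "m = p" by (simp add: m_def True flip: scaleR_add_left)
    then show ?thesis using f by (auto simp: p_def)
  next
    case False
    define Q where "Q x y = cinner (shifted A m x) y / (q - p)" for x y
    have Q_add: "Q (x + x') y = Q x y + Q x' y" "Q x (y + y') = Q x y + Q x y'" for x x' y y'
      by (simp_all add: Q_def blinfun.add_right cinner_add_left cinner_add_right add_divide_distrib)
    have Q_scale: "Q (a *\<^sub>C x) y = a * Q x y" "Q x (a *\<^sub>C y) = cnj a * Q x y" for a x y
      by (simp_all add: Q_def shifted_scaleC[OF A] cinner_scaleC_left cinner_scaleC_right)
    have Qf: "Q f f = of_real (- t)" and Qg: "Q g g = of_real (1 - t)"
      using False f g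
      by (auto simp: Q_def shifted_apply cinner_diff_left cinner_scaleC_left cinner_self
          m_def scaleR_conv_of_real field_simps simp flip: p_def q_def)
    \<comment> \<open>The cross terms along the segment are multiples of \<open>c * Q g f + cnj c * Q f g\<close>, whose
      imaginary part is that of \<open>c * d\<close>; the phase \<open>c\<close> makes \<open>c * d\<close> real.\<close>
    define d where "d = Q g f - cnj (Q f g)"
    define c where "c = (if d = 0 then 1 else cnj (sgn d))"
    have c1: "cmod c = 1" by (simp add: c_def norm_sgn)
    have cc: "c * cnj c = 1" using c1 complex_norm_square[of c] by simp
    have "c * d = of_real (cmod d)"
      using complex_norm_square[of d]
      by (auto simp: c_def sgn_eq power2_eq_square field_simps)
    then have "Im (c * d) = 0" by simp
    then have im: "Im (c * Q g f + cnj c * Q f g) = 0"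
      by (simp add: d_def algebra_simps)
    define \<beta> where "\<beta> = Re (c * Q g f + cnj c * Q f g)"
    have \<beta>: "c * Q g f + cnj c * Q f g = of_real \<beta>"
      using im by (simp add: \<beta>_def complex_eq_iff)
    define h where "h s = of_real (1 - s) *\<^sub>C f + (of_real s * c) *\<^sub>C g" for s
    define \<psi> where "\<psi> s = (1 - s)\<^sup>2 * (- t) + s\<^sup>2 * (1 - t) + s * (1 - s) * \<beta>" for s
    have Qh: "Q (h s) (h s) = of_real (\<psi> s)" for s
    proof -
      have "Q (h s) (h s) = of_real ((1 - s)\<^sup>2) * Q f f + of_real (s\<^sup>2) * (c * cnj c) * Q g g
          + of_real (s * (1 - s)) * (c * Q g f + cnj c * Q f g)"
        by (simp add: h_def Q_add Q_scale power2_eq_square algebra_simps)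
      also have "\<dots> = of_real (\<psi> s)"
        unfolding Qf Qg \<beta> cc by (simp add: \<psi>_def)
      finally show ?thesis .
    qed
    have "\<exists>s\<ge>0. s \<le> 1 \<and> \<psi> s = 0"
      by (rule IVT') (use t in \<open>auto simp: \<psi>_def intro!: continuous_intros\<close>)
    then obtain s where s: "0 \<le> s" "s \<le> 1" "\<psi> s = 0" by blast
    have hn: "h s \<noteq> 0"
    proof
      \<comment> \<open>Otherwise \<open>f\<close> and \<open>g\<close> agree up to a phase, and then \<open>p = q\<close>.\<close>
      assume h0: "h s = 0"
      then have eq: "of_real (1 - s) *\<^sub>C f = - ((of_real s * c) *\<^sub>C g)"
        by (simp add: h_def add_eq_0_iff2)
      from arg_cong[OF eq, of norm] have "s = 1 / 2"
        using s f g c1 by (simp add: norm_scaleC norm_mult del: of_real_diff)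
      with eq have "(1/2) *\<^sub>C f = (1/2) *\<^sub>C ((- c) *\<^sub>C g)"
        by (simp add: scaleC_scaleC scaleC_minus_left
            bounded_linear.linear[OF bounded_linear_scaleC, THEN linear_neg])
      from arg_cong[OF this, of "\<lambda>x. 2 *\<^sub>C x"] have "f = (- c) *\<^sub>C g"
        by (simp add: scaleC_scaleC scaleC_one)
      then have "p = c * cnj c * q"
        unfolding p_def q_def
        by (simp add: bounded_operators_scaleC[OF A] cinner_scaleC_left cinner_scaleC_right)
      then show False using False cc by simp
    qed
    define u where "u = h s /\<^sub>R norm (h s)"
    have nu: "norm u = 1" using hn by (simp add: u_def)
    have "cinner (shifted A m (h s)) (h s) = 0"
      using Qh[of s] s(3) False by (simp add: Q_def)
    then have "cinner (shifted A m u) u = 0"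
      by (simp add: u_def blinfun.scaleR_right cinner_scaleR_left cinner_scaleR_right)
    then have "cinner (A u) u = m"
      using nu by (simp add: shifted_apply cinner_diff_left cinner_scaleC_left cinner_self)
    with nu show ?thesis by blast
  qed
  then show "\<exists>h. (1 - t) *\<^sub>R cinner (A f) f + t *\<^sub>R cinner (A g) g = cinner (A h) h \<and> norm h = 1"
    unfolding m_def p_def q_def by metis
qed

lemma compact_closed_numerical_range: "compact (closed_numerical_range A)"
  unfolding compact_eq_bounded_closed
proof
  show "bounded (closed_numerical_range A)"
    by (rule boundedI[where B="norm A"]) (rule norm_le_of_closed_numerical_range)
qed (simp add: closed_numerical_range_def)

lemma cinner_in_closed_numerical_range:
  fixes A :: "'h::complex_hilbert \<Rightarrow>\<^sub>L 'h"
  shows "norm f = 1 \<Longrightarrow> cinner (A f) f \<in> closed_numerical_range A"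
  unfolding closed_numerical_range_def using closure_subset by fast

lemma quadratic_form_lower_bound:
  fixes A :: "'h::complex_hilbert \<Rightarrow>\<^sub>L 'h"
  assumes "\<And>z. z \<in> closed_numerical_range A \<Longrightarrow> b \<le> inner a z"
  shows "b * (norm f)\<^sup>2 \<le> inner a (cinner (A f) f)"
proof (cases "f = 0")
  case False
  define u where "u = f /\<^sub>R norm f"
  have f: "f = norm f *\<^sub>R u" and u: "norm u = 1" using False by (auto simp: u_def)
  have "cinner (A f) f = (norm f)\<^sup>2 *\<^sub>R cinner (A u) u"
    by (subst (1 2) f)
      (simp add: blinfun.scaleR_right cinner_scaleR_left cinner_scaleR_right scaleR_conv_of_real power2_eq_square)
  then show ?thesis
    using assms[OF cinner_in_closed_numerical_range[OF u]]
    by (simp add: mult.commute[of b] mult_left_mono)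
qed simp

lemma closed_convex_memberI:
  fixes S :: "complex set"
  assumes "convex S" "closed S"
    and half: "\<And>a b. (\<And>w. w \<in> S \<Longrightarrow> b \<le> inner a w) \<Longrightarrow> b \<le> inner a z"
  shows "z \<in> S"
proof (rule ccontr)
  assume "z \<notin> S"
  then obtain a b where "inner a z < b" "\<And>x. x \<in> S \<Longrightarrow> b < inner a x"
    using separating_hyperplane_closed_point[OF assms(1,2)] by blast
  with half[of b a] show False by force
qed

text \<open>
  For finitely supported \<open>f\<close>, split off \<open>g \<otimes> u\<close>, where \<open>u\<close> is the direction of one value of \<open>f\<close> and
  \<open>g\<close> is the slice of \<open>f\<close> along \<open>u\<close>.  The remainder vanishes at one more point and has zero slice along \<open>u\<close>,
  a property preserved by \<open>H0 \<otimes> I\<close>; so neither the norm nor the form has cross terms, and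
  induction on the support applies.  The general case follows by density.
\<close>

lemma tensor_identity_lower_bound:
  fixes f :: "('x, 'k::complex_hilbert) ell2"
  assumes H0: "H0 \<in> bounded_operators"
    and lb: "\<And>g. b * (norm g)\<^sup>2 \<le> inner a (cinner (H0 g) g)"
  shows "b * (norm f)\<^sup>2 \<le> inner a (cinner (tensor_identity H0 f) f)"
proof -
  let ?T = "tensor_identity H0 :: ('x, 'k) ell2 \<Rightarrow>\<^sub>L ('x, 'k) ell2"
  have fin: "b * (norm f)\<^sup>2 \<le> inner a (cinner (?T f) f)"
    if "finite F" "\<And>x. x \<notin> F \<Longrightarrow> ell2_apply f x = 0" for F and f :: "('x, 'k) ell2"
    using that
  proof (induction F arbitrary: f rule: finite_induct)
    case empty
    then have "f = 0" by (intro ell2_eqI) (simp add: zero_ell2.rep_eq)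
    then show ?case by simp
  next
    case (insert y F)
    show ?case
    proof (cases "ell2_apply f y = 0")
      case True
      then show ?thesis using insert by (metis insertE)
    next
      case False
      define u where "u = ell2_apply f y /\<^sub>R norm (ell2_apply f y)"
      have nu: "norm u = 1" using False by (simp add: u_def)
      have uu: "cinner u u = 1" using nu by (simp add: cinner_self)
      define g where "g = slice u f"
      define f' where "f' = f - tensor_ell2 g u"
      have f: "f = tensor_ell2 g u + f'" by (simp add: f'_def)
      have ap: "ell2_apply f' x = ell2_apply f x - cinner (ell2_apply f x) u *\<^sub>C u" for x
        by (simp add: f'_def g_def minus_ell2.rep_eq tensor_ell2.rep_eq slice.rep_eq)
      have y0: "ell2_apply f' y = 0"
      proof -
        have fy: "ell2_apply f y = of_real (norm (ell2_apply f y)) *\<^sub>C u"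
          using False by (simp add: u_def scaleC_of_real)
        have "cinner (ell2_apply f y) u = of_real (norm (ell2_apply f y))"
          by (subst fy) (simp add: cinner_scaleC_left uu)
        then show ?thesis unfolding ap using fy by simp
      qed
      have supp: "ell2_apply f' x = 0" if "x \<notin> F" for x
      proof (cases "x = y")
        case False
        then have "ell2_apply f x = 0" using that insert.prems by auto
        then show ?thesis by (simp add: ap scaleC_zero_left)
      qed (use y0 in simp)
      have slice0: "slice u f' = 0"
        by (rule ell2_eqI) (simp add: slice.rep_eq ap cinner_diff_left cinner_scaleC_left uu zero_ell2.rep_eq)
      have orth: "cinner f' (tensor_ell2 h u) = 0" for h
        by (simp add: cinner_tensor_right slice0)
      have orth': "cinner (tensor_ell2 h u) f' = 0" for h
        using orth[of h] by (metis cinner_commute complex_cnj_zero)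
      have "cinner (?T f') (tensor_ell2 g u) = 0"
        by (simp add: cinner_tensor_right slice_tensor_identity[OF H0] slice0)
      moreover have "cinner (tensor_ell2 (H0 g) u) (tensor_ell2 g u) = cinner (H0 g) g"
        by (simp add: cinner_tensor_right slice_tensor uu scaleC_one)
      ultimately have Q: "cinner (?T f) f = cinner (H0 g) g + cinner (?T f') f'"
        by (simp add: f blinfun.add_right cinner_add_left cinner_add_right
            tensor_identity_tensor[OF H0] orth')
      have "orthogonal (tensor_ell2 g u) f'"
        by (simp add: orthogonal_def inner_eq_Re_cinner orth')
      then have "(norm f)\<^sup>2 = (norm g)\<^sup>2 + (norm f')\<^sup>2"
        by (subst f) (simp add: norm_add_Pythagorean norm_tensor_ell2 nu)
      then show ?thesis
        using insert.IH[OF supp] lb[of g] by (simp add: Q inner_add_right distrib_left)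
    qed
  qed
  show ?thesis
  proof (rule tendsto_le[OF finite_subsets_at_top_neq_bot])
    show "((\<lambda>F. b * (norm (restriction F f))\<^sup>2) \<longlongrightarrow> b * (norm f)\<^sup>2) (finite_subsets_at_top UNIV)"
      by (intro tendsto_intros restriction_tendsto)
    show "((\<lambda>F. inner a (cinner (?T (restriction F f)) (restriction F f)))
        \<longlongrightarrow> inner a (cinner (?T f) f)) (finite_subsets_at_top UNIV)"
      by (intro tendsto_intros bounded_bilinear.tendsto[OF bounded_bilinear_cinner]
          bounded_linear.tendsto[OF blinfun.bounded_linear_right] restriction_tendsto)
    show "\<forall>\<^sub>F F in finite_subsets_at_top UNIV. b * (norm (restriction F f))\<^sup>2
        \<le> inner a (cinner (?T (restriction F f)) (restriction F f))"
      by (intro eventually_finite_subsets_at_top_weakI, erule fin) (simp add: restriction.rep_eq)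
  qed
qed

lemma potential_lower_bound:
  fixes V :: "'x \<Rightarrow> 'k::complex_hilbert \<Rightarrow>\<^sub>L 'k" and f :: "('x, 'k) ell2"
  assumes V: "bounded (range V)"
    and lb: "\<And>x k. b * (norm k)\<^sup>2 \<le> inner a (cinner (V x k) k)"
  shows "b * (norm f)\<^sup>2 \<le> inner a (cinner (potential_operator V f) f)"
proof (rule has_sum_mono)
  show "((\<lambda>x. b * (norm (ell2_apply f x))\<^sup>2) has_sum b * (norm f)\<^sup>2) UNIV"
    using ell2_apply[of f] unfolding norm_ell2_square
    by (intro has_sum_cmult_right has_sum_infsum) (simp add: square_summable_def)
  have "((\<lambda>x. cinner (V x (ell2_apply f x)) (ell2_apply f x)) has_sum cinner (potential_operator V f) f) UNIV"
    using cinner_summable[of "ell2_apply (potential_operator V f)" "ell2_apply f"]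
      ell2_apply[of f] ell2_apply[of "potential_operator V f"]
    by (simp add: cinner_ell2.rep_eq potential_operator_apply[OF V])
  from has_sum_bounded_linear[OF bounded_linear_inner_right this]
  show "((\<lambda>x. inner a (cinner (V x (ell2_apply f x)) (ell2_apply f x)))
      has_sum inner a (cinner (potential_operator V f) f)) UNIV" .
qed (rule lb)

text \<open>
  The sum on the right is closed because the numerical range of \<open>H0\<close> is compact.
\<close>

lemma spectrum_tensor_potential_subset:
  fixes H0 :: "('x, complex) ell2 \<Rightarrow>\<^sub>L ('x, complex) ell2"
    and V :: "'x \<Rightarrow> 'k::complex_hilbert \<Rightarrow>\<^sub>L 'k"
  assumes H0: "H0 \<in> bounded_operators"
    and M: "M \<subseteq> bounded_operators" "bounded M" and VM: "range V \<subseteq> M"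
  shows "spectrum (tensor_identity H0 + potential_operator V)
    \<subseteq> closed_numerical_range H0 + closed_convex_hull (family_numerical_range M)"
proof -
  let ?H = "tensor_identity H0 + potential_operator V"
  let ?N = "closed_numerical_range H0" and ?C = "closed_convex_hull (family_numerical_range M)"
  have Vb: "bounded (range V)" using bounded_subset[OF M(2) VM] .
  have Hb: "?H \<in> bounded_operators"
    using M VM Vb by (auto intro!: bounded_operators_add tensor_identity_bounded[OF H0]
        potential_bounded_operator)
  have convN: "convex ?N"
    unfolding closed_numerical_range_def by (intro convex_closure convex_numerical_range H0)
  have convC: "convex ?C" "closed ?C" by (simp_all add: closed_convex_hull_def)
  have NV: "closed_numerical_range (V x) \<subseteq> ?C" for x
  proof -
    have "closed_numerical_range (V x) \<subseteq> family_numerical_range M"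
      using VM closure_subset unfolding family_numerical_range_def by fast
    then show ?thesis
      unfolding closed_convex_hull_def by (meson closure_subset hull_subset order_trans)
  qed
  have "cinner (?H f) f \<in> ?N + ?C" if f: "norm f = 1" for f
  proof -
    have "cinner (tensor_identity H0 f) f \<in> ?N"
    proof (rule closed_convex_memberI[OF convN])
      show "closed ?N" by (simp add: closed_numerical_range_def)
      show "b \<le> inner a (cinner (tensor_identity H0 f) f)" if "\<And>w. w \<in> ?N \<Longrightarrow> b \<le> inner a w" for a b
        using tensor_identity_lower_bound[OF H0 quadratic_form_lower_bound[OF that], of f] f by simp
    qed
    moreover have "cinner (potential_operator V f) f \<in> ?C"
    proof (rule closed_convex_memberI[OF convC])
      show "b \<le> inner a (cinner (potential_operator V f) f)" if "\<And>w. w \<in> ?C \<Longrightarrow> b \<le> inner a w" for a b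
        using potential_lower_bound[OF Vb quadratic_form_lower_bound, of b a f] NV that f by fastforce
    qed
    ultimately show ?thesis
      by (auto simp: blinfun.add_left cinner_add_left)
  qed
  then have "{cinner (?H f) f | f. norm f = 1} \<subseteq> ?N + ?C" by blast
  moreover have "closed (?N + ?C)"
  proof -
    have "?N + ?C = (\<Union>x\<in>?N. \<Union>y\<in>?C. {x + y})" by (auto simp: set_plus_def)
    then show ?thesis
      using compact_closed_sums[OF compact_closed_numerical_range convC(2), of H0] by simp
  qed
  ultimately have "closed_numerical_range ?H \<subseteq> ?N + ?C"
    unfolding closed_numerical_range_def[of ?H] by (rule closure_minimal)
  then show ?thesis using spectrum_subset_numerical_range[OF Hb] by blast
qed

section \<open>Normal operators\<close>

lemma normal_operator_shifted:
  fixes A :: "'h::complex_hilbert \<Rightarrow>\<^sub>L 'h"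
  assumes "normal_operator A"
  shows "normal_operator (shifted A c)"
proof -
  obtain B :: "'h \<Rightarrow>\<^sub>L 'h" where B: "B \<in> bounded_operators" "\<And>f g. cinner (A f) g = cinner f (B g)"
    and comm: "A o\<^sub>L B = B o\<^sub>L A"
    using assms unfolding normal_operator_def by blast
  have "A (B f) = B (A f)" for f
    using arg_cong[OF comm, of "\<lambda>T. blinfun_apply T f"] by simp
  moreover have A: "A (a *\<^sub>C f) = a *\<^sub>C A f" for a f
  proof -
    have "cinner (A (a *\<^sub>C f) - a *\<^sub>C A f) g = 0" for g
      by (simp add: cinner_diff_left cinner_scaleC_left B(2))
    from this[of "A (a *\<^sub>C f) - a *\<^sub>C A f"] show ?thesis by (simp add: cinner_self)
  qed
  ultimately have "shifted A c o\<^sub>L shifted B (cnj c) = shifted B (cnj c) o\<^sub>L shifted A c"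
    by (intro blinfun_eqI) (simp add: shifted_apply blinfun.diff_right bounded_operators_scaleC[OF B(1)]
        scaleC_diff_right scaleC_scaleC mult.commute)
  moreover have "cinner (shifted A c f) g = cinner f (shifted B (cnj c) g)" for f g
    by (simp add: shifted_apply cinner_diff_left cinner_diff_right cinner_scaleC_left
        cinner_scaleC_right B(2))
  moreover have "shifted B (cnj c) \<in> bounded_operators"
    using shifted_scaleC[OF B(1)] by (simp add: bounded_operators_def)
  ultimately show ?thesis unfolding normal_operator_def by blast
qed

text \<open>
  With \<open>B\<close> the adjoint, the left side is \<open>\<langle>f, B (A f)\<rangle>\<close>, and normality gives
  \<open>\<parallel>B (A f)\<parallel> = \<parallel>A (A f)\<parallel>\<close>.
\<close>

lemma normal_operator_norm_square_le:
  fixes A :: "'h::complex_hilbert \<Rightarrow>\<^sub>L 'h"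
  assumes "normal_operator A"
  shows "(norm (A f))\<^sup>2 \<le> norm (A (A f)) * norm f"
proof -
  obtain B :: "'h \<Rightarrow>\<^sub>L 'h" where B: "\<And>f g. cinner (A f) g = cinner f (B g)" and comm: "A o\<^sub>L B = B o\<^sub>L A"
    using assms unfolding normal_operator_def by blast
  have AB: "A (B f) = B (A f)" for f
    using arg_cong[OF comm, of "\<lambda>T. blinfun_apply T f"] by simp
  have adj: "norm (B g) = norm (A g)" for g
  proof -
    have "cinner (A g) (A g) = cnj (cinner (B g) (B g))"
      by (metis B AB cinner_commute)
    then show ?thesis by (simp add: cinner_self flip: of_real_power)
  qed
  have "complex_of_real ((norm (A f))\<^sup>2) = cinner f (B (A f))"
    by (metis B cinner_self)
  then have "(norm (A f))\<^sup>2 = cmod (cinner f (B (A f)))"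
    by (metis norm_of_real abs_of_nonneg zero_le_power2)
  also have "\<dots> \<le> norm f * norm (B (A f))" by (rule cmod_cinner_le)
  finally show ?thesis by (simp add: adj mult.commute)
qed

text \<open>
  By \<open>normal_operator_norm_square_le\<close> the orbit norms form a log-convex sequence, so their successive
  ratios never fall below the first one.
\<close>

lemma normal_operator_norm_power_ge:
  fixes A :: "'h::complex_hilbert \<Rightarrow>\<^sub>L 'h"
  assumes A: "normal_operator A" and u: "norm u = 1"
  shows "norm (A u) ^ j \<le> norm ((blinfun_apply A ^^ j) u)"
proof -
  define a where "a j = norm ((blinfun_apply A ^^ j) u)" for j
  have step: "a 1 * a j \<le> a (Suc j)" for j
  proof (induction j)
    case 0
    show ?case by (simp add: a_def u)
  next
    case (Suc j)
    show ?case
    proof (cases "a j = 0")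
      case True
      then have "a (Suc j) = 0" by (simp add: a_def)
      then show ?thesis by (simp add: a_def)
    next
      case False
      then have pos: "a j > 0" by (simp add: a_def)
      have "(a 1 * a (Suc j)) * a j \<le> a (Suc j) * a (Suc j)"
        using mult_left_mono[OF Suc, of "a (Suc j)"] by (simp add: a_def mult_ac)
      also have "\<dots> \<le> a (Suc (Suc j)) * a j"
        using normal_operator_norm_square_le[OF A, of "(blinfun_apply A ^^ j) u"]
        by (simp add: a_def power2_eq_square)
      finally show ?thesis using pos by simp
    qed
  qed
  have "a 1 ^ j \<le> a j" for j
  proof (induction j)
    case (Suc j)
    have "a 1 ^ Suc j \<le> a 1 * a j" using Suc by (simp add: a_def mult_left_mono)
    then show ?case using step[of j] by linarith
  qed (simp add: a_def u)
  then show ?thesis by (simp add: a_def)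
qed

lemma roots_of_unity_orthogonal:
  fixes n :: nat
  assumes "j < n" "l < n"
  defines "\<zeta> \<equiv> \<lambda>k :: nat. cis (2 * pi * real k / real n)"
  shows "(\<Sum>k<n. \<zeta> k ^ j * cnj (\<zeta> k ^ l)) = (if j = l then of_nat n else 0)"
proof -
  have n: "n > 0" using assms by simp
  define q where "q = \<zeta> j * cnj (\<zeta> l)"
  have one: "\<zeta> k * cnj (\<zeta> k) = 1" for k
    using complex_norm_square[of "\<zeta> k"] by (simp add: \<zeta>_def)
  have swap: "\<zeta> k ^ i = \<zeta> i ^ k" for k i
    by (simp add: \<zeta>_def Complex.DeMoivre mult_ac)
  have qk: "\<zeta> k ^ j * cnj (\<zeta> k ^ l) = q ^ k" for k
    by (simp add: q_def swap[of k] power_mult_distrib)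
  show ?thesis
  proof (cases "j = l")
    case True
    then have "q = 1" using one by (simp add: q_def)
    then show ?thesis unfolding qk using True by simp
  next
    case False
    have "\<zeta> j \<noteq> \<zeta> l"
      using Complex.bij_betw_roots_unity[OF n] assms(1,2) False unfolding bij_betw_def inj_on_def \<zeta>_def by blast
    then have "q \<noteq> 1"
      using one[of l] unfolding q_def by (metis mult.assoc mult.commute mult.right_neutral)
    moreover have "\<zeta> i ^ n = 1" for i
      using n by (simp add: \<zeta>_def Complex.DeMoivre cis_multiple_2pi)
    then have "q ^ n = 1"
      by (simp add: q_def power_mult_distrib flip: complex_cnj_power)
    ultimately show ?thesis unfolding qk using False by (simp add: geometric_sum)
  qed
qed

lemma parseval_roots_of_unity:
  fixes v :: "nat \<Rightarrow> 'h::complex_hilbert" and n :: nat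
  defines "\<zeta> \<equiv> \<lambda>k :: nat. cis (2 * pi * real k / real n)"
  shows "(\<Sum>k<n. (norm (\<Sum>j<n. \<zeta> k ^ j *\<^sub>C v j))\<^sup>2) = real n * (\<Sum>j<n. (norm (v j))\<^sup>2)"
proof -
  have "complex_of_real (\<Sum>k<n. (norm (\<Sum>j<n. \<zeta> k ^ j *\<^sub>C v j))\<^sup>2)
      = (\<Sum>k<n. \<Sum>j<n. \<Sum>l<n. (\<zeta> k ^ j * cnj (\<zeta> k ^ l)) * cinner (v j) (v l))"
    unfolding of_real_sum
  proof (intro sum.cong refl)
    fix k
    have "complex_of_real ((norm (\<Sum>j<n. \<zeta> k ^ j *\<^sub>C v j))\<^sup>2)
        = (\<Sum>j<n. cinner (\<zeta> k ^ j *\<^sub>C v j) (\<Sum>l<n. \<zeta> k ^ l *\<^sub>C v l))"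
      by (simp only: cinner_self[symmetric] cinner_sum_left)
    also have "\<dots> = (\<Sum>j<n. \<Sum>l<n. (\<zeta> k ^ j * cnj (\<zeta> k ^ l)) * cinner (v j) (v l))"
      by (simp add: cinner_sum_right cinner_scaleC_left cinner_scaleC_right mult_ac sum_distrib_left)
    finally show "complex_of_real ((norm (\<Sum>j<n. \<zeta> k ^ j *\<^sub>C v j))\<^sup>2)
        = (\<Sum>j<n. \<Sum>l<n. (\<zeta> k ^ j * cnj (\<zeta> k ^ l)) * cinner (v j) (v l))" .
  qed
  also have "\<dots> = (\<Sum>j<n. \<Sum>l<n. (\<Sum>k<n. \<zeta> k ^ j * cnj (\<zeta> k ^ l)) * cinner (v j) (v l))"
    unfolding sum_distrib_right
    by (subst sum.swap, rule sum.cong[OF refl], subst sum.swap, rule refl)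
  also have "\<dots> = (\<Sum>j<n. \<Sum>l<n. if j = l then of_nat n * cinner (v j) (v j) else 0)"
    unfolding \<zeta>_def
    by (intro sum.cong refl, subst roots_of_unity_orthogonal) auto
  also have "\<dots> = complex_of_real (real n * (\<Sum>j<n. (norm (v j))\<^sup>2))"
    by (simp add: cinner_self sum_distrib_left)
  finally show ?thesis using of_real_eq_iff by blast
qed

text \<open>
  The vectors \<open>h k\<close> are the discrete Fourier transform of the orbit \<open>v j = r\<^sup>-\<^sup>j N\<^sup>j u\<close>.  By Parseval
  one of them is long, as \<open>v j\<close> has norm at least \<open>1 / 2\<close> for \<open>j < n\<close>.  Since \<open>N\<close> shifts the orbit, \<open>N - \<mu>\<close>
  leaves only the two ends of the sum, of norm at most \<open>1\<close> each before the factor \<open>\<mu>\<close>.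
\<close>

lemma normal_operator_almost_eigenvector_on_circle:
  fixes N :: "'h::complex_hilbert \<Rightarrow>\<^sub>L 'h"
  assumes Nb: "N \<in> bounded_operators" and N: "normal_operator N" and N0: "N \<noteq> 0" and n: "n > 0"
  shows "\<exists>\<mu> h. cmod \<mu> = norm N \<and> almost_eigenvector N \<mu> (4 * norm N / sqrt (real n)) h"
proof -
  define r where "r = norm N"
  have r: "r > 0" using N0 by (simp add: r_def)
  \<comment> \<open>Chosen so that \<open>d ^ j \<ge> 1 / 2\<close> for all \<open>j < n\<close>, by Bernoulli's inequality.\<close>
  define d where "d = 1 - 1 / (2 * real n)"
  have d: "0 \<le> d" "d < 1" using n by (auto simp: d_def field_simps)
  obtain u where u: "norm u = 1" "d * r \<le> norm (N u)"
  proof (rule ccontr)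
    assume no: "\<not> thesis"
    have "norm (N f) \<le> (d * r) * norm f" for f
    proof (cases "f = 0")
      case False
      have "\<not> d * r \<le> norm (N (f /\<^sub>R norm f))"
        using no that[of "f /\<^sub>R norm f"] False by auto
      then show ?thesis using False by (simp add: blinfun.scaleR_right field_simps)
    qed simp
    then have "r \<le> d * r" unfolding r_def
      by (intro norm_blinfun_bound) (use d in auto)
    then show False using d r by simp
  qed
  define \<zeta> where "\<zeta> k = cis (2 * pi * real k / real n)" for k :: nat
  define v where "v j = (blinfun_apply N ^^ j) u /\<^sub>R r ^ j" for j
  have v_ge: "1 / 2 \<le> norm (v j)" if "j < n" for j
  proof -
    have "1 / 2 \<le> 1 + real j * (- 1 / (2 * real n))" using that n by (simp add: field_simps)
    also have "\<dots> \<le> (1 + (- 1 / (2 * real n))) ^ j"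
      using n by (intro Bernoulli_inequality) (simp add: field_simps)
    also have "\<dots> = d ^ j" by (simp add: d_def)
    finally have "1 / 2 * r ^ j \<le> (d * r) ^ j"
      using r by (simp add: power_mult_distrib mult_right_mono)
    also have "\<dots> \<le> norm (N u) ^ j" using u d r by (intro power_mono) auto
    also have "\<dots> \<le> norm ((blinfun_apply N ^^ j) u)"
      by (rule normal_operator_norm_power_ge[OF N u(1)])
    finally show ?thesis using r by (simp add: v_def field_simps)
  qed
  have v_le: "norm (v j) \<le> 1" for j
  proof -
    have "norm ((blinfun_apply N ^^ j) u) \<le> r ^ j"
    proof (induction j)
      case (Suc j)
      have "norm ((blinfun_apply N ^^ Suc j) u) \<le> r * norm ((blinfun_apply N ^^ j) u)"
        by (simp add: r_def norm_blinfun)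
      also have "\<dots> \<le> r * r ^ j" using Suc r by (intro mult_left_mono) auto
      finally show ?case by simp
    qed (simp add: u)
    then show ?thesis using r by (simp add: v_def field_simps)
  qed
  define h where "h k = (\<Sum>j<n. \<zeta> k ^ j *\<^sub>C v j)" for k
  have "\<exists>k<n. real n / 4 \<le> (norm (h k))\<^sup>2"
  proof (rule ccontr)
    assume "\<not> ?thesis"
    then have "(\<Sum>k<n. (norm (h k))\<^sup>2) < (\<Sum>k<n. real n / 4)"
      using n by (intro sum_strict_mono) auto
    moreover have "(\<Sum>j<n. (norm (v j))\<^sup>2) \<ge> (\<Sum>j<n. (1 / 2)\<^sup>2)"
      by (intro sum_mono power_mono v_ge) auto
    then have "real n * (\<Sum>j<n. (norm (v j))\<^sup>2) \<ge> real n * (real n / 4)"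
      by (intro mult_left_mono) (auto simp: power2_eq_square)
    ultimately show False
      unfolding h_def \<zeta>_def parseval_roots_of_unity by simp
  qed
  then obtain k where k: "real n / 4 \<le> (norm (h k))\<^sup>2" by blast
  define \<mu> where "\<mu> = of_real r * cnj (\<zeta> k)"
  have \<zeta>1: "cmod (\<zeta> k) = 1" by (simp add: \<zeta>_def)
  have \<zeta>\<zeta>: "cnj (\<zeta> k) * \<zeta> k = 1"
    using complex_norm_square[of "\<zeta> k"] \<zeta>1 by (simp add: mult.commute)
  have Nv: "N (v j) = r *\<^sub>R v (Suc j)" for j
    using r by (simp add: v_def blinfun.scaleR_right)
  have Nw: "N (\<zeta> k ^ j *\<^sub>C v j) = \<mu> *\<^sub>C (\<zeta> k ^ Suc j *\<^sub>C v (Suc j))" for j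
  proof -
    have "\<mu> * \<zeta> k ^ Suc j = of_real r * \<zeta> k ^ j"
      using \<zeta>\<zeta> by (simp add: \<mu>_def mult.assoc flip: mult.assoc[of "cnj (\<zeta> k)"])
    then show ?thesis
      by (simp add: bounded_operators_scaleC[OF Nb] Nv scaleC_scaleC flip: scaleC_of_real del: power_Suc)
        (simp add: mult.commute)
  qed
  have "shifted N \<mu> (h k) = \<mu> *\<^sub>C (\<Sum>j<n. \<zeta> k ^ Suc j *\<^sub>C v (Suc j) - \<zeta> k ^ j *\<^sub>C v j)"
    unfolding h_def shifted_apply blinfun.sum_right Nw
    by (simp only: scaleC_sum_right sum_subtractf scaleC_diff_right)
  also have "\<dots> = \<mu> *\<^sub>C (\<zeta> k ^ n *\<^sub>C v n - v 0)"
    by (subst sum_lessThan_telescope) (simp add: scaleC_one)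
  finally have sh: "shifted N \<mu> (h k) = \<mu> *\<^sub>C (\<zeta> k ^ n *\<^sub>C v n - v 0)" .
  have \<mu>r: "cmod \<mu> = r" using r \<zeta>1 by (simp add: \<mu>_def norm_mult)
  have "norm (\<zeta> k ^ n *\<^sub>C v n - v 0) \<le> 2"
    using norm_triangle_ineq4[of "\<zeta> k ^ n *\<^sub>C v n" "v 0"] v_le[of n] v_le[of 0]
    by (simp add: norm_scaleC norm_power \<zeta>1)
  then have sh_le: "norm (shifted N \<mu> (h k)) \<le> 2 * r"
    unfolding sh using r by (simp add: norm_scaleC \<mu>r)
  have "sqrt (real n / 4) \<le> norm (h k)" using k by (intro real_le_lsqrt) auto
  then have hn: "sqrt (real n) / 2 \<le> norm (h k)" by (simp add: real_sqrt_divide)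
  have sn: "sqrt (real n) > 0" using n by simp
  have hp: "norm (h k) > 0" using hn sn by linarith
  have "almost_eigenvector N \<mu> (4 * r / sqrt (real n)) (h k /\<^sub>R norm (h k))"
  proof -
    have "norm (shifted N \<mu> (h k /\<^sub>R norm (h k))) = norm (shifted N \<mu> (h k)) / norm (h k)"
      by (simp add: blinfun.scaleR_right field_simps)
    also have "\<dots> \<le> 2 * r / (sqrt (real n) / 2)"
      using sh_le hn sn r by (intro frac_le) auto
    finally show ?thesis using hp by (simp add: almost_eigenvector_def)
  qed
  then show ?thesis using \<mu>r unfolding r_def by blast
qed

text \<open>
  The almost eigenvalues found on the circle for growing \<open>n\<close> accumulate at a point of the spectrum.
\<close>

lemma normal_operator_spectral_radius:
  fixes N :: "'h::complex_hilbert \<Rightarrow>\<^sub>L 'h"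
  assumes Nb: "N \<in> bounded_operators" and N: "normal_operator N" and N0: "N \<noteq> 0"
  shows "\<exists>\<mu>\<in>spectrum N. cmod \<mu> = norm N"
proof -
  obtain \<mu> h where \<mu>: "\<And>n. cmod (\<mu> n) = norm N"
    and h: "\<And>n. almost_eigenvector N (\<mu> n) (4 * norm N / sqrt (real (Suc n))) (h n)"
    using normal_operator_almost_eigenvector_on_circle[OF Nb N N0, of "Suc n" for n] by (metis zero_less_Suc)
  have "\<mu> n \<in> sphere 0 (norm N)" for n using \<mu> by simp
  then obtain l s where l: "l \<in> sphere 0 (norm N)" and s: "strict_mono s" "(\<mu> \<circ> s) \<longlonglongrightarrow> l"
    using compact_sphere[of "0 :: complex" "norm N"] unfolding compact_def by metis
  define err where "err n = 4 * norm N / sqrt (real (Suc n)) + cmod (\<mu> n - l)" for n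
  have "(\<lambda>n. 4 * norm N * sqrt (inverse (real (Suc n)))) \<longlonglongrightarrow> 4 * norm N * sqrt 0"
    by (intro tendsto_intros LIMSEQ_inverse_real_of_nat)
  from LIMSEQ_subseq_LIMSEQ[OF this s(1)]
  have "(\<lambda>n. 4 * norm N / sqrt (real (Suc (s n)))) \<longlonglongrightarrow> 0"
    by (simp add: o_def real_sqrt_inverse real_sqrt_divide field_simps)
  moreover have "(\<lambda>n. cmod (\<mu> (s n) - l)) \<longlonglongrightarrow> 0"
    using s(2) by (simp add: o_def LIM_zero tendsto_norm_zero)
  ultimately have err: "(\<lambda>n. err (s n)) \<longlonglongrightarrow> 0"
    unfolding err_def using tendsto_add by fastforce
  have "l \<in> spectrum N"
    unfolding spectrum_iff_almost_eigenvectors[OF Nb]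
  proof (intro allI impI)
    fix e :: real assume "e > 0"
    then have "\<forall>\<^sub>F n in sequentially. err (s n) < e"
      using err order_tendstoD(2) by blast
    then obtain n where "err (s n) < e" using eventually_sequentially by auto
    moreover have "almost_eigenvector N l (err (s n)) (h (s n))"
      unfolding err_def by (rule almost_eigenvector_perturb[OF h])
    ultimately show "\<exists>g. almost_eigenvector N l e g"
      using almost_eigenvector_mono less_imp_le by blast
  qed
  then show ?thesis using l by (intro bexI[of _ l]) auto
qed

text \<open>
  The normal operator \<open>N = A - c\<close> has \<open>\<bar>\<langle>N g, g\<rangle>\<bar> \<le> \<parallel>N\<parallel>\<close> and a point of its spectrum has modulus
  \<open>\<parallel>N\<parallel>\<close>.  So a disc about \<open>c\<close> that contains the spectrum of \<open>A\<close> contains the numerical range.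
\<close>

lemma normal_numerical_range_in_discs:
  fixes A :: "'h::complex_hilbert \<Rightarrow>\<^sub>L 'h"
  assumes Ab: "A \<in> bounded_operators" and A: "normal_operator A" and g: "norm g = 1"
  shows "\<exists>\<mu>\<in>spectrum A. cmod (cinner (A g) g - c) \<le> cmod (\<mu> - c)"
proof -
  define N where "N = shifted A c"
  have Ng: "cinner (N g) g = cinner (A g) g - c"
    using g by (simp add: N_def shifted_apply cinner_diff_left cinner_scaleC_left cinner_self)
  have Nb: "N \<in> bounded_operators"
    using shifted_scaleC[OF Ab] by (simp add: N_def bounded_operators_def)
  show ?thesis
  proof (cases "N = 0")
    case True
    have "almost_eigenvector A c e g" if "e > 0" for e
      using that g True by (simp add: almost_eigenvector_def N_def)
    then have "c \<in> spectrum A" using spectrum_iff_almost_eigenvectors[OF Ab] by blast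
    then show ?thesis using Ng True by (intro bexI[of _ c]) auto
  next
    case False
    then obtain \<mu> where \<mu>: "\<mu> \<in> spectrum N" "cmod \<mu> = norm N"
      using normal_operator_spectral_radius[OF Nb] normal_operator_shifted[OF A] N_def by blast
    have "shifted N \<mu> f = shifted A (\<mu> + c) f" for f
      by (simp add: N_def shifted_apply scaleC_add_left)
    then have "\<mu> + c \<in> spectrum A"
      using \<mu>(1) unfolding spectrum_iff_almost_eigenvectors[OF Ab] spectrum_iff_almost_eigenvectors[OF Nb]
        almost_eigenvector_def by simp
    moreover have "cmod (cinner (N g) g) \<le> norm N"
      using cmod_cinner_le[of "N g" g] norm_blinfun[of N g] g by simp
    ultimately show ?thesis using Ng \<mu>(2) by (intro bexI[of _ "\<mu> + c"]) auto
  qed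
qed

text \<open>
  A line separating a point \<open>w\<close> of the numerical range from the convex hull can be bent into a large circle
  about the far point \<open>s *\<^sub>R a\<close>.  The spectrum is bounded, so for large \<open>s\<close> some disc about that point
  contains the spectrum but not \<open>w\<close>.
\<close>

lemma normal_numerical_range_subset:
  fixes A :: "'h::complex_hilbert \<Rightarrow>\<^sub>L 'h"
  assumes Ab: "A \<in> bounded_operators" and A: "normal_operator A"
  shows "closed_numerical_range A \<subseteq> closed_convex_hull (spectrum A)"
proof -
  have "cinner (A g) g \<in> closed_convex_hull (spectrum A)" if g: "norm g = 1" for g
  proof (rule ccontr)
    define w where "w = cinner (A g) g"
    assume "cinner (A g) g \<notin> closed_convex_hull (spectrum A)"
    then obtain a b where ab: "inner a w < b" "\<And>x. x \<in> closed_convex_hull (spectrum A) \<Longrightarrow> b < inner a x"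
      using separating_hyperplane_closed_point[of "closed_convex_hull (spectrum A)" w]
      by (auto simp: closed_convex_hull_def w_def)
    \<comment> \<open>In \<open>(cmod (x - s *\<^sub>R a))\<^sup>2\<close> the term \<open>2 * s * inner a x\<close> must outweigh the variation of
      \<open>(cmod x)\<^sup>2\<close>, which is at most \<open>(norm A)\<^sup>2\<close>.\<close>
    define s where "s = ((norm A)\<^sup>2 + 1) / (2 * (b - inner a w))"
    have s: "s > 0" using ab(1) by (simp add: s_def add_nonneg_pos)
    obtain \<mu> where \<mu>: "\<mu> \<in> spectrum A" "cmod (w - s *\<^sub>R a) \<le> cmod (\<mu> - s *\<^sub>R a)"
      using normal_numerical_range_in_discs[OF Ab A g, of "s *\<^sub>R a"] by (auto simp: w_def)
    have sq: "(cmod (x - s *\<^sub>R a))\<^sup>2 = (cmod x)\<^sup>2 - 2 * s * inner a x + s\<^sup>2 * (cmod a)\<^sup>2" for x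
      unfolding power2_norm_eq_inner
      by (simp add: inner_diff_left inner_diff_right inner_commute power2_eq_square algebra_simps)
    have "\<mu> \<in> closed_convex_hull (spectrum A)"
      using \<mu>(1) unfolding closed_convex_hull_def by (meson closure_subset hull_subset subsetD)
    then have "s * b \<le> s * inner a \<mu>" using ab(2) s by (intro mult_left_mono) (auto simp: less_imp_le)
    moreover have "(cmod w)\<^sup>2 - 2 * (s * inner a w) \<le> (cmod \<mu>)\<^sup>2 - 2 * (s * inner a \<mu>)"
      using power_mono[OF \<mu>(2) norm_ge_zero, of 2] by (simp add: sq mult.assoc)
    moreover have "(cmod \<mu>)\<^sup>2 \<le> (norm A)\<^sup>2"
      using norm_le_of_closed_numerical_range spectrum_subset_numerical_range[OF Ab] \<mu>(1)
      by (intro power_mono) auto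
    moreover have "s * (2 * (b - inner a w)) = (norm A)\<^sup>2 + 1"
      using ab(1) by (simp add: s_def)
    then have "2 * (s * b) - 2 * (s * inner a w) = (norm A)\<^sup>2 + 1"
      by (simp add: algebra_simps)
    moreover have "0 \<le> (cmod w)\<^sup>2" by simp
    ultimately show False by linarith
  qed
  then have "{cinner (A f) f | f. norm f = 1} \<subseteq> closed_convex_hull (spectrum A)" by blast
  then show ?thesis
    unfolding closed_numerical_range_def by (rule closure_minimal) (simp add: closed_convex_hull_def)
qed

lemma closed_convex_hull_minimal:
  "S \<subseteq> T \<Longrightarrow> convex T \<Longrightarrow> closed T \<Longrightarrow> closed_convex_hull S \<subseteq> T"
  unfolding closed_convex_hull_def by (simp add: closure_minimal hull_minimal)

section \<open>The spectrum of a pseudo-ergodic operator\<close>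

lemma normal_family_numerical_range_subset:
  assumes M: "M \<subseteq> bounded_operators" and normal: "\<forall>A\<in>M. normal_operator A"
  shows "closed_convex_hull (family_numerical_range M) \<subseteq> closed_convex_hull (family_spectrum M)"
proof (rule closed_convex_hull_minimal)
  have "closed_numerical_range A \<subseteq> closed_convex_hull (family_spectrum M)" if A: "A \<in> M" for A
  proof -
    have "spectrum A \<subseteq> family_spectrum M"
      using A closure_subset unfolding family_spectrum_def by fast
    then have "closed_convex_hull (spectrum A) \<subseteq> closed_convex_hull (family_spectrum M)"
      unfolding closed_convex_hull_def by (intro closure_mono hull_mono)
    then show ?thesis using normal_numerical_range_subset M normal A by blast
  qed
  then show "family_numerical_range M \<subseteq> closed_convex_hull (family_spectrum M)"
    unfolding family_numerical_range_def
    by (intro closure_minimal) (auto simp: closed_convex_hull_def)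
qed (simp_all add: closed_convex_hull_def)

theorem theorem3:
  fixes \<Gamma> :: "('g, 'm) monoid_scheme"
    and \<phi> :: "'g \<Rightarrow> 'x::countable \<Rightarrow> 'x"
    and H0 :: "('x, complex) ell2 \<Rightarrow>\<^sub>L ('x, complex) ell2"
    and M :: "('k::complex_hilbert \<Rightarrow>\<^sub>L 'k) set"
    and V :: "'x \<Rightarrow> 'k \<Rightarrow>\<^sub>L 'k"
    and H :: "('x, 'k) ell2 \<Rightarrow>\<^sub>L ('x, 'k) ell2"
  assumes action: "group_action \<Gamma> UNIV \<phi>"
    and H0_bounded: "H0 \<in> bounded_operators"
    and H0_invariant: "\<And>\<gamma>. \<gamma> \<in> carrier \<Gamma> \<Longrightarrow>
      H0 o\<^sub>L translation \<Gamma> \<phi> \<gamma> = translation \<Gamma> \<phi> \<gamma> o\<^sub>L H0"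
    and M_operators: "M \<subseteq> bounded_operators"
    and M_closed: "closed M"
    and M_bounded: "bounded M"
    and V_pseudo_ergodic: "pseudo_ergodic \<Gamma> \<phi> M V"
    and H_eq: "H = tensor_identity H0 + potential_operator V"
  shows "spectrum H0 + family_spectrum M \<subseteq> spectrum H \<and>
    spectrum H \<subseteq> closed_numerical_range H0 + closed_convex_hull (family_numerical_range M) \<and>
    (normal_operator H0 \<and> (\<forall>A\<in>M. normal_operator A) \<longrightarrow>
      spectrum H \<subseteq> closed_convex_hull (spectrum H0) + closed_convex_hull (family_spectrum M))"
proof (intro conjI impI)
  have VM: "range V \<subseteq> M" using V_pseudo_ergodic by (simp add: pseudo_ergodic_def)
  have Hb: "H \<in> bounded_operators"
    unfolding H_eq using VM M_operators bounded_subset[OF M_bounded VM]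
    by (auto intro!: bounded_operators_add tensor_identity_bounded[OF H0_bounded]
        potential_bounded_operator)
  show "spectrum H0 + family_spectrum M \<subseteq> spectrum H"
  proof
    fix x assume "x \<in> spectrum H0 + family_spectrum M"
    then obtain z w where x: "x = z + w" and z: "z \<in> spectrum H0" and w: "w \<in> family_spectrum M"
      by (auto simp: set_plus_def)
    have "(\<Union>A\<in>M. spectrum A) \<subseteq> (\<lambda>w. z + w) -` spectrum H"
      using spectrum_sum_constant_potential[OF H0_bounded _ z] M_operators
        spectrum_constant_potential_subset[OF action H0_bounded H0_invariant M_operators
          M_bounded V_pseudo_ergodic]
      unfolding H_eq by blast
    moreover have "closed ((\<lambda>w. z + w) -` spectrum H)"
      by (intro closed_vimage closed_spectrum Hb continuous_intros)
    ultimately have "family_spectrum M \<subseteq> (\<lambda>w. z + w) -` spectrum H"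
      unfolding family_spectrum_def by (rule closure_minimal)
    then show "x \<in> spectrum H" using w x by auto
  qed
  show upper: "spectrum H \<subseteq> closed_numerical_range H0 + closed_convex_hull (family_numerical_range M)"
    unfolding H_eq by (rule spectrum_tensor_potential_subset[OF H0_bounded M_operators M_bounded VM])
  assume "normal_operator H0 \<and> (\<forall>A\<in>M. normal_operator A)"
  then show "spectrum H \<subseteq> closed_convex_hull (spectrum H0) + closed_convex_hull (family_spectrum M)"
    using upper set_plus_mono2[OF normal_numerical_range_subset[OF H0_bounded]
        normal_family_numerical_range_subset[OF M_operators]] by blast
qed

end
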